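(* Let $\lambda,\mu$ be partitions with $\mu\subseteq\lambda$ and let $r\ge 0$ be an integer. Then $$s_{\lambda/\mu}\cdot\widetilde p_r=\sum_{j=0}^r(-1)^{r+1-j}\sum_{\lambda^+,\mu^-}(-1)^{\mathrm{wt}(\lambda^+/\lambda)+\mathrm{ht}(\mu/\mu^-)}\,q^{\mathrm{ht}(\lambda^+/\lambda)+\mathrm{wt}(\mu/\mu^-)}\,(q-1)^{\mathrm{rib}(\lambda^+/\lambda)+\mathrm{rib}(\mu/\mu^-)-1}\,s_{\lambda^+/\mu^-},$$ where the inner sum is over all pairs of partitions $\lambda^+\supseteq\lambda$, $\mu^-\subseteq\mu$ such that $\lambda^+/\lambda$ is a broken ribbon of size $r-j$ and $\mu/\mu^-$ is a broken ribbon of size $j$.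
   Context: For partitions, $\mu\subseteq\lambda$ means $\mu_i\le\lambda_i$ for all $i$ (with $\lambda_i=0$ for $i>\ell(\lambda)$, where $\ell(\lambda)$ is the number of parts). The skew diagram is $[\lambda/\mu]=\{(i,j):1\le i\le\ell(\lambda),\ \mu_i<j\le\lambda_i\}$ (row $i$, column $j$, rows numbered from top to bottom), and its size is $|\lambda/\mu|=|\lambda|-|\mu|$. A skew shape $\lambda/\mu$ is a ribbon if $[\lambda/\mu]$ is (non-empty and) connected and contains no $2\times 2$ block. It is a broken ribbon if $[\lambda/\mu]$ contains no $2\times2$ block (the empty shape is allowed); its diagram is then a disjoint union of $\mathrm{rib}(\lambda/\mu)$ ribbons (its connected components). The height $\mathrm{ht}$ (resp. width $\mathrm{wt}$) of a ribbon is the number of its non-empty rows (resp. columns) minus $1$; the height (resp. width) of a broken ribbon is the sum of the heights (resp. widths) of its component ribbons. The empty shape has height, width and $\mathrm{rib}$ all equal to $0$. $s_{\lambda/\mu}$ is the skew Schur function in $x_1,x_2,\dots$, $m_\tau$ is the monomial symmetric function, and $q$ is an indeterminate. The quantum power sum function is $$\widetilde p_r=\sum_{\tau\vdash r}(-1)^{\ell(\tau)-1}(q-1)^{\ell(\tau)-1}m_\tau .$$ For $r=0$ this formula is read literally (with $\tau=\emptyset$, $\ell(\tau)=0$, $m_\emptyset=1$). *)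

theory Defs
  imports
    "HOL-Library.Poly_Mapping"
    "HOL-Library.FuncSet"
    "HOL-Library.Multiset"
    "HOL-Computational_Algebra.Polynomial"
    "HOL-Computational_Algebra.Fraction_Field"
begin

section \<open>Formal power series in countably many variables\<close>

text \<open>
  A monomial is a finitely supported exponent vector \<open>nat \<Rightarrow>\<^sub>0 nat\<close>; the variables
  \<open>x\<^sub>1, x\<^sub>2, \<dots>\<close> are indexed by \<^typ>\<open>nat\<close>, starting from 0.  Symmetric functions live in
  the ring of all formal power series in these variables.
\<close>

typedef 'a mfps = "UNIV :: ((nat \<Rightarrow>\<^sub>0 nat) \<Rightarrow> 'a) set"
  morphisms mcoeff Abs_mfps
  by simp

setup_lifting type_definition_mfps

lemma mfps_eqI: "(\<And>\<alpha>. mcoeff f \<alpha> = mcoeff g \<alpha>) \<Longrightarrow> f = g"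
  by (auto simp: mcoeff_inject[symmetric])

definition antidiag :: "(nat \<Rightarrow>\<^sub>0 nat) \<Rightarrow> ((nat \<Rightarrow>\<^sub>0 nat) \<times> (nat \<Rightarrow>\<^sub>0 nat)) set" where
  "antidiag \<alpha> = {(\<beta>, \<gamma>). \<beta> + \<gamma> = \<alpha>}"

lemma finite_antidiag [simp]: "finite (antidiag \<alpha>)"
proof -
  let ?M = "Max (insert 0 (Poly_Mapping.lookup \<alpha> ` Poly_Mapping.keys \<alpha>))"
  let ?F = "{f. \<forall>i. (i \<in> Poly_Mapping.keys \<alpha> \<longrightarrow> f i \<in> {..?M}) \<and>
                   (i \<notin> Poly_Mapping.keys \<alpha> \<longrightarrow> f i = (0::nat))}"
  define B where "B = {\<beta> :: nat \<Rightarrow>\<^sub>0 nat. \<forall>i. Poly_Mapping.lookup \<beta> i \<le> Poly_Mapping.lookup \<alpha> i}"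
  have "finite ?F"
    by (rule finite_set_of_finite_funs) auto
  moreover have "Poly_Mapping.lookup ` B \<subseteq> ?F"
  proof (intro subsetI CollectI allI conjI impI)
    fix f i assume "f \<in> Poly_Mapping.lookup ` B" "i \<in> Poly_Mapping.keys \<alpha>"
    then have "f i \<le> Poly_Mapping.lookup \<alpha> i" by (auto simp: B_def)
    also have "\<dots> \<le> ?M"
      using \<open>i \<in> Poly_Mapping.keys \<alpha>\<close> by (intro Max_ge) auto
    finally show "f i \<in> {..?M}" by simp
  next
    fix f i assume "f \<in> Poly_Mapping.lookup ` B" "i \<notin> Poly_Mapping.keys \<alpha>"
    moreover from this have "f i \<le> Poly_Mapping.lookup \<alpha> i"
      by (auto simp: B_def)
    ultimately show "f i = 0" by (simp add: in_keys_iff)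
  qed
  ultimately have "finite (Poly_Mapping.lookup ` B)" by (rule rev_finite_subset)
  then have "finite B"
    by (rule finite_imageD) (auto intro!: inj_onI simp: lookup_inject)
  then have "finite (B \<times> B)" by simp
  moreover have "antidiag \<alpha> \<subseteq> B \<times> B"
    by (auto simp: antidiag_def B_def lookup_add)
  ultimately show ?thesis by (rule rev_finite_subset)
qed

instantiation mfps :: (comm_ring_1) comm_ring_1
begin

lift_definition zero_mfps :: "'a mfps" is "\<lambda>_. 0" .
lift_definition one_mfps :: "'a mfps" is "\<lambda>\<alpha>. if \<alpha> = 0 then 1 else 0" .
lift_definition plus_mfps :: "'a mfps \<Rightarrow> 'a mfps \<Rightarrow> 'a mfps" is "\<lambda>f g \<alpha>. f \<alpha> + g \<alpha>" .
lift_definition minus_mfps :: "'a mfps \<Rightarrow> 'a mfps \<Rightarrow> 'a mfps" is "\<lambda>f g \<alpha>. f \<alpha> - g \<alpha>" .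
lift_definition uminus_mfps :: "'a mfps \<Rightarrow> 'a mfps" is "\<lambda>f \<alpha>. - f \<alpha>" .
lift_definition times_mfps :: "'a mfps \<Rightarrow> 'a mfps \<Rightarrow> 'a mfps" is
  "\<lambda>f g \<alpha>. \<Sum>(\<beta>, \<gamma>) \<in> antidiag \<alpha>. f \<beta> * g \<gamma>" .

instance
proof
  fix f g h :: "'a mfps"
  show "f * g * h = f * (g * h)"
  proof (transfer, rule ext)
    fix f g h :: "(nat \<Rightarrow>\<^sub>0 nat) \<Rightarrow> 'a" and \<alpha>
    have "(\<Sum>(\<beta>, \<gamma>)\<in>antidiag \<alpha>. (\<Sum>(\<delta>, \<epsilon>)\<in>antidiag \<beta>. f \<delta> * g \<epsilon>) * h \<gamma>) =
      (\<Sum>(p, r)\<in>Sigma (antidiag \<alpha>) (\<lambda>p. antidiag (fst p)). f (fst r) * g (snd r) * h (snd p))"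
      by (subst sum.Sigma[symmetric]) (auto simp: sum_distrib_right split_def)
    also have "\<dots> = (\<Sum>(p, r)\<in>Sigma (antidiag \<alpha>) (\<lambda>p. antidiag (snd p)).
        f (fst p) * (g (fst r) * h (snd r)))"
      by (rule sum.reindex_bij_witness
          [where i = "\<lambda>(p, r). ((fst p + fst r, snd r), (fst p, fst r))"
             and j = "\<lambda>(p, r). ((fst r, snd r + snd p), (snd r, snd p))"])
         (auto simp: antidiag_def algebra_simps)
    also have "\<dots> = (\<Sum>(\<beta>, \<gamma>)\<in>antidiag \<alpha>. f \<beta> * (\<Sum>(\<delta>, \<epsilon>)\<in>antidiag \<gamma>. g \<delta> * h \<epsilon>))"
      by (subst sum.Sigma[symmetric]) (auto simp: sum_distrib_left split_def)
    finally show "(\<Sum>(\<beta>, \<gamma>)\<in>antidiag \<alpha>. (\<Sum>(\<delta>, \<epsilon>)\<in>antidiag \<beta>. f \<delta> * g \<epsilon>) * h \<gamma>) =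
      (\<Sum>(\<beta>, \<gamma>)\<in>antidiag \<alpha>. f \<beta> * (\<Sum>(\<delta>, \<epsilon>)\<in>antidiag \<gamma>. g \<delta> * h \<epsilon>))" .
  qed
  show "f * g = g * f"
  proof (transfer, rule ext)
    fix f g :: "(nat \<Rightarrow>\<^sub>0 nat) \<Rightarrow> 'a" and \<alpha>
    show "(\<Sum>(\<beta>, \<gamma>)\<in>antidiag \<alpha>. f \<beta> * g \<gamma>) = (\<Sum>(\<beta>, \<gamma>)\<in>antidiag \<alpha>. g \<beta> * f \<gamma>)"
      by (rule sum.reindex_bij_witness[where i = prod.swap and j = prod.swap])
         (auto simp: antidiag_def algebra_simps)
  qed
  show "1 * f = f"
  proof (transfer, rule ext)
    fix f :: "(nat \<Rightarrow>\<^sub>0 nat) \<Rightarrow> 'a" and \<alpha>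
    have "(\<Sum>(\<beta>, \<gamma>)\<in>antidiag \<alpha>. (if \<beta> = 0 then 1 else 0) * f \<gamma>) =
          (\<Sum>(\<beta>, \<gamma>)\<in>{(0 :: nat \<Rightarrow>\<^sub>0 nat, \<alpha>)}. (if \<beta> = 0 then 1 else 0) * f \<gamma>)"
    proof (rule sum.mono_neutral_right)
      show "{(0, \<alpha>)} \<subseteq> antidiag \<alpha>"
        by (simp add: antidiag_def)
    qed (auto simp: antidiag_def[of \<alpha>] split: if_splits simp del: finite_antidiag
        intro: finite_antidiag[unfolded antidiag_def])
    then show "(\<Sum>(\<beta>, \<gamma>)\<in>antidiag \<alpha>. (if \<beta> = 0 then 1 else 0) * f \<gamma>) = f \<alpha>"
      by simp
  qed
  show "(f + g) * h = f * h + g * h"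
    by (transfer, rule ext) (simp add: split_def distrib_right sum.distrib)
  show "(0::'a mfps) \<noteq> 1"
    by transfer (auto dest: fun_cong[where x = 0])
qed (transfer; force simp: algebra_simps)+

end

lift_definition mscale :: "'a::comm_ring_1 \<Rightarrow> 'a mfps \<Rightarrow> 'a mfps" is
  "\<lambda>c f \<alpha>. c * f \<alpha>" .


section \<open>Partitions and skew diagrams\<close>

definition is_partition :: "nat list \<Rightarrow> bool" where
  "is_partition lam \<longleftrightarrow> sorted_wrt (\<ge>) lam \<and> 0 \<notin> set lam"

definition part :: "nat list \<Rightarrow> nat \<Rightarrow> nat" where
  "part lam i = (if 1 \<le> i \<and> i \<le> length lam then lam ! (i - 1) else 0)"

definition partitions_of :: "nat \<Rightarrow> nat list set" where
  "partitions_of n = {\<tau>. is_partition \<tau> \<and> sum_list \<tau> = n}"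

definition contained :: "nat list \<Rightarrow> nat list \<Rightarrow> bool" where
  "contained mu lam \<longleftrightarrow> (\<forall>i\<ge>1. part mu i \<le> part lam i)"

definition skew_diagram :: "nat list \<Rightarrow> nat list \<Rightarrow> (nat \<times> nat) set" where
  "skew_diagram lam mu = {(i, j). 1 \<le> i \<and> i \<le> length lam \<and> part mu i < j \<and> j \<le> part lam i}"

definition skew_size :: "nat list \<Rightarrow> nat list \<Rightarrow> nat" where
  "skew_size lam mu = sum_list lam - sum_list mu"

lemma finite_partitions_of [simp]: "finite (partitions_of n)"
proof -
  have "length xs \<le> sum_list xs" if "0 \<notin> set xs" for xs :: "nat list"
    using that by (induction xs) auto
  then have "partitions_of n \<subseteq> {xs. set xs \<subseteq> {..n} \<and> length xs \<le> n}"
    by (auto simp: partitions_of_def is_partition_def intro: member_le_sum_list)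
  then show ?thesis
    by (rule finite_subset) (simp add: finite_lists_length_le)
qed

lemma finite_skew_diagram [simp]: "finite (skew_diagram lam mu)"
proof -
  have "part lam i \<le> sum_list lam" for i
    by (auto simp: part_def intro!: member_le_sum_list)
  then have "skew_diagram lam mu \<subseteq> {..length lam} \<times> {..sum_list lam}"
    by (auto simp: skew_diagram_def intro: order_trans)
  then show ?thesis by (rule finite_subset) simp
qed


section \<open>Broken ribbons\<close>

text \<open>Connectedness of a diagram is taken along common edges of cells.\<close>

definition adjacent :: "nat \<times> nat \<Rightarrow> nat \<times> nat \<Rightarrow> bool" where
  "adjacent c d \<longleftrightarrow>
     (fst c = fst d \<and> (snd c = Suc (snd d) \<or> snd d = Suc (snd c))) \<or>
     (snd c = snd d \<and> (fst c = Suc (fst d) \<or> fst d = Suc (fst c)))"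

definition linked :: "(nat \<times> nat) set \<Rightarrow> ((nat \<times> nat) \<times> (nat \<times> nat)) set" where
  "linked D = {(c, d). c \<in> D \<and> d \<in> D \<and> (c, d) \<in> {(a, b). a \<in> D \<and> b \<in> D \<and> adjacent a b}\<^sup>*}"

definition components :: "(nat \<times> nat) set \<Rightarrow> (nat \<times> nat) set set" where
  "components D = D // linked D"

definition has_2x2_block :: "(nat \<times> nat) set \<Rightarrow> bool" where
  "has_2x2_block D \<longleftrightarrow> (\<exists>i j. {(i, j), (i, Suc j), (Suc i, j), (Suc i, Suc j)} \<subseteq> D)"

definition is_broken_ribbon :: "nat list \<Rightarrow> nat list \<Rightarrow> bool" where
  "is_broken_ribbon lam mu \<longleftrightarrow> contained mu lam \<and> \<not> has_2x2_block (skew_diagram lam mu)"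

definition rib :: "nat list \<Rightarrow> nat list \<Rightarrow> nat" where
  "rib lam mu = card (components (skew_diagram lam mu))"

definition ht :: "nat list \<Rightarrow> nat list \<Rightarrow> nat" where
  "ht lam mu = (\<Sum>R\<in>components (skew_diagram lam mu). (card (fst ` R) - 1))"

definition wt :: "nat list \<Rightarrow> nat list \<Rightarrow> nat" where
  "wt lam mu = (\<Sum>R\<in>components (skew_diagram lam mu). (card (snd ` R) - 1))"


section \<open>Skew Schur functions and quantum power sums\<close>

text \<open>Tableaux are extensional functions, so that each filling is counted once.\<close>

definition ssyt :: "nat list \<Rightarrow> nat list \<Rightarrow> (nat \<times> nat \<Rightarrow> nat) set" where
  "ssyt lam mu = {T \<in> skew_diagram lam mu \<rightarrow>\<^sub>E UNIV.
     (\<forall>i j j'. (i, j) \<in> skew_diagram lam mu \<and> (i, j') \<in> skew_diagram lam mu \<and> j < j'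
        \<longrightarrow> T (i, j) \<le> T (i, j')) \<and>
     (\<forall>i i' j. (i, j) \<in> skew_diagram lam mu \<and> (i', j) \<in> skew_diagram lam mu \<and> i < i'
        \<longrightarrow> T (i, j) < T (i', j))}"

definition content :: "nat list \<Rightarrow> nat list \<Rightarrow> (nat \<times> nat \<Rightarrow> nat) \<Rightarrow> (nat \<Rightarrow>\<^sub>0 nat)" where
  "content lam mu T = (\<Sum>c\<in>skew_diagram lam mu. Poly_Mapping.single (T c) 1)"

lemma finite_ssyt_content [simp]: "finite {T \<in> ssyt lam mu. content lam mu T = \<alpha>}"
proof -
  have "T c \<in> Poly_Mapping.keys (content lam mu T)" if "c \<in> skew_diagram lam mu" for T c
  proof -
    have "1 \<le> Poly_Mapping.lookup (Poly_Mapping.single (T c) (1::nat)) (T c)" by simp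
    also have "\<dots> \<le> (\<Sum>d\<in>skew_diagram lam mu. Poly_Mapping.lookup (Poly_Mapping.single (T d) 1) (T c))"
      by (rule member_le_sum) (use that in auto)
    also have "\<dots> = Poly_Mapping.lookup (content lam mu T) (T c)"
      by (simp add: content_def lookup_sum)
    finally show ?thesis by (auto simp: in_keys_iff)
  qed
  then have "{T \<in> ssyt lam mu. content lam mu T = \<alpha>} \<subseteq> skew_diagram lam mu \<rightarrow>\<^sub>E Poly_Mapping.keys \<alpha>"
    by (auto simp: ssyt_def PiE_iff extensional_def)
  then show ?thesis by (rule finite_subset) (simp add: finite_PiE)
qed

definition skew_schur :: "nat list \<Rightarrow> nat list \<Rightarrow> 'a::comm_ring_1 mfps" where
  "skew_schur lam mu = Abs_mfps (\<lambda>\<alpha>. of_nat (card {T \<in> ssyt lam mu. content lam mu T = \<alpha>}))"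

definition monomial_sym :: "nat list \<Rightarrow> 'a::comm_ring_1 mfps" where
  "monomial_sym \<tau> =
     Abs_mfps (\<lambda>\<alpha>.
       if image_mset (Poly_Mapping.lookup \<alpha>) (mset_set (Poly_Mapping.keys \<alpha>)) = mset \<tau>
       then 1 else 0)"

text \<open>The coefficient field is \<open>\<rat>(q)\<close>: for \<open>r = 0\<close> the factor \<open>(q - 1)\<^sup>-\<^sup>1\<close> occurs.\<close>

type_synonym qfield = "rat poly fract"

definition q :: qfield where
  "q = Fract [:0, 1:] 1"

definition quantum_power_sum :: "nat \<Rightarrow> qfield mfps" where
  "quantum_power_sum r =
     (\<Sum>\<tau>\<in>partitions_of r.
        mscale ((-1) powi (int (length \<tau>) - 1) * (q - 1) powi (int (length \<tau>) - 1))
          (monomial_sym \<tau>))"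

definition ribbon_pairs ::
  "nat list \<Rightarrow> nat list \<Rightarrow> nat \<Rightarrow> nat \<Rightarrow> (nat list \<times> nat list) set" where
  "ribbon_pairs lam mu a b =
     {(lam_p, mu_m). is_partition lam_p \<and> is_partition mu_m \<and> contained lam lam_p \<and> contained mu_m mu \<and>
        is_broken_ribbon lam_p lam \<and> skew_size lam_p lam = a \<and>
        is_broken_ribbon mu mu_m \<and> skew_size mu mu_m = b}"

lemma finite_ribbon_pairs [simp]: "finite (ribbon_pairs lam mu a b)"
proof -
  have *: "sum_list nu \<le> sum_list ka" if "contained nu ka" "is_partition nu" for nu ka
  proof -
    have le: "length nu \<le> length ka"
    proof (rule ccontr)
      assume "\<not> length nu \<le> length ka"
      then have *: "length nu \<ge> 1" "length ka < length nu" by linarith+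
      then have "part nu (length nu) \<le> part ka (length nu)"
        using that(1) by (simp add: contained_def)
      with * have "nu ! (length nu - 1) = 0" "length nu - 1 < length nu"
        by (auto simp: part_def)
      then show False using that(2) by (metis is_partition_def nth_mem)
    qed
    have "sum_list nu = (\<Sum>i<length nu. nu ! i)"
      by (simp add: sum_list_sum_nth atLeast0LessThan)
    also have "\<dots> \<le> (\<Sum>i<length nu. ka ! i)"
    proof (rule sum_mono)
      fix i assume "i \<in> {..<length nu}"
      then show "nu ! i \<le> ka ! i"
        using that(1)[unfolded contained_def, rule_format, of "Suc i"] le
        by (simp add: part_def)
    qed
    also have "\<dots> \<le> (\<Sum>i<length ka. ka ! i)"
      using le by (intro sum_mono2) auto
    also have "\<dots> = sum_list ka"
      by (simp add: sum_list_sum_nth atLeast0LessThan)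
    finally show ?thesis .
  qed
  have "ribbon_pairs lam mu a b \<subseteq>
    (\<Union>n\<le>sum_list lam + a. partitions_of n) \<times> (\<Union>n\<le>sum_list mu. partitions_of n)"
    by (auto simp: ribbon_pairs_def partitions_of_def skew_size_def intro: *)
  then show ?thesis
    by (rule finite_subset) auto
qed

end

theory Submission
  imports Defs "HOL-Computational_Algebra.Formal_Power_Series"
begin

text \<open>
  The quantum power sums have the generating function
  \<^item> \<open>(1 - q) * (\<Sum>r. p r * t ^ r) = (\<Prod>i. (1 - q * x i * t) / (1 - x i * t)) = H(t) E(- q t)\<close>,

  where \<open>H\<close> and \<open>E\<close> generate the complete and the elementary symmetric functions.  The theorem is
  therefore an expansion of \<open>s * H(1) * E(- q)\<close>, sorted by degree.

  Let \<open>S\<close> be the matrix, indexed by partitions, whose entries are the skew Schur functions.  By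
  the branching rule for tableaux (\<open>card_tableaux_recursion\<close>), \<open>S\<close> is a product of one matrix \<open>U(x)\<close> for
  each variable \<open>x\<close>, and \<open>U(x)\<close> removes horizontal strips.  Let \<open>H(a)\<close> and \<open>E(b)\<close> now denote the matrices
  that add horizontal and vertical strips, with weight \<open>a\<close> or \<open>b\<close> for each added cell.  Two
  combinatorial facts drive the proof.

  \<^item> \<open>H(a) U(x) = 1 / (1 - a x) U(x) H(a)\<close>.  This is a bijection between shapes above and
    shapes below a pair of partitions; it reflects each part in the interval that interlacing leaves
    to it (\<open>common_horizontal_strips\<close>, \<open>shifts_add_hstrip\<close>).

  \<^item> The entries of \<open>H(a) E(b)\<close> are supported on broken ribbons, with the value
    \<open>a ^ wt * b ^ ht * (a + b) ^ rib\<close> (\<open>sum_strip_between\<close>).  Indeed, if a broken ribbon is cut into a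
    horizontal strip followed by a vertical strip, then the position of every cell is forced, except
    for the last cell of the top row of each component.

  For \<open>b = - a\<close> the second fact says that \<open>E(- a)\<close> is inverse to \<open>H(a)\<close>, so the first fact also yields
  \<open>E(- a) U(x) = (1 - a x) U(x) E(- a)\<close>.  Consequently \<open>A = H(1) E(- q)\<close> satisfies \<open>A S = F S A\<close> with
  \<open>F = H(1) E(- q)\<close> as a symmetric function, and \<open>A\<close> has the inverse \<open>A' = H(q) E(- 1)\<close>.  Hence
  \<open>F S = A S A'\<close> (\<open>schur_coeff_ribbon_conjugation\<close>).  By the second fact the entries of \<open>A\<close> and \<open>A'\<close> are
  the weights of the broken ribbons that are added to \<open>\<lambda>\<close> and removed from \<open>\<mu>\<close>, and dividing by \<open>1 - q\<close>
  gives the expansion.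
\<close>

section \<open>Partitions and their parts\<close>

lemma part_Suc_le:
  assumes "is_partition lam" "1 \<le> i"
  shows "part lam (Suc i) \<le> part lam i"
proof (cases "i < length lam")
  case True
  then have "lam ! i \<le> lam ! (i - 1)"
    using assms by (auto simp: is_partition_def sorted_wrt_iff_nth_less)
  then show ?thesis using True assms by (simp add: part_def)
qed (simp add: part_def)

lemma part_antimono:
  assumes "is_partition lam" "1 \<le> i" "i \<le> j"
  shows "part lam j \<le> part lam i"
  using assms(3)
proof (induction rule: dec_induct)
  case (step n)
  then show ?case using part_Suc_le[OF assms(1), of n] assms(2) by linarith
qed simp

lemma part_beyond_length: "length lam < i \<Longrightarrow> part lam i = 0"
  by (simp add: part_def)

lemma part_eq_0_iff:
  assumes "is_partition lam" "1 \<le> i"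
  shows "part lam i = 0 \<longleftrightarrow> length lam < i"
proof -
  have "lam ! (i - 1) > 0" if "i \<le> length lam"
  proof -
    have "lam ! (i - 1) \<in> set lam" using assms that by (intro nth_mem) auto
    then show ?thesis using assms by (auto simp: is_partition_def intro: gr0I)
  qed
  then show ?thesis using assms by (auto simp: part_def)
qed

lemma partition_eqI:
  assumes "is_partition lam" "is_partition mu" "\<And>i. 1 \<le> i \<Longrightarrow> part lam i = part mu i"
  shows "lam = mu"
proof (rule nth_equalityI)
  have "\<And>i. 1 \<le> i \<Longrightarrow> length lam < i \<longleftrightarrow> length mu < i"
    using assms by (metis part_eq_0_iff)
  from this[of "Suc (length lam)"] this[of "Suc (length mu)"]
  show "length lam = length mu" by auto
  then show "lam ! i = mu ! i" if "i < length lam" for i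
    using assms(3)[of "Suc i"] that by (simp add: part_def)
qed

lemma sum_list_eq_sum_part:
  assumes "length lam \<le> M"
  shows "sum_list lam = (\<Sum>i=1..M. part lam i)"
proof -
  have "sum_list lam = (\<Sum>i<length lam. part lam (Suc i))"
    by (simp add: sum_list_sum_nth atLeast0LessThan part_def)
  also have "\<dots> = (\<Sum>i<M. part lam (Suc i))"
    using assms by (intro sum.mono_neutral_left) (auto simp: part_def)
  also have "\<dots> = (\<Sum>i=1..M. part lam i)"
    by (rule sum.reindex_bij_witness[where i = "\<lambda>i. i - 1" and j = Suc]) auto
  finally show ?thesis .
qed

lemma partition_from_parts:
  assumes "\<And>i. 1 \<le> i \<Longrightarrow> f (Suc i) \<le> f i" "f (Suc M) = 0"
  obtains lam where "is_partition lam" "\<And>i. 1 \<le> i \<Longrightarrow> part lam i = f i"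
proof -
  have anti: "f j \<le> f i" if "1 \<le> i" "i \<le> j" for i j
    using that(2)
  proof (induction rule: dec_induct)
    case (step n)
    then show ?case using assms(1)[of n] that(1) by linarith
  qed simp
  define l where "l = (LEAST l. f (Suc l) = 0)"
  have l0: "f (Suc l) = 0" unfolding l_def by (rule LeastI[where P = "\<lambda>l. f (Suc l) = 0"], fact)
  have lpos: "f (Suc i) > 0" if "i < l" for i
    using not_less_Least[of i "\<lambda>l. f (Suc l) = 0"] that unfolding l_def by auto
  let ?lam = "map (\<lambda>i. f (Suc i)) [0..<l]"
  have "is_partition ?lam"
    using lpos by (force simp: is_partition_def sorted_wrt_iff_nth_less intro!: anti)
  moreover have "part ?lam i = f i" if "1 \<le> i" for i
  proof (cases "i \<le> l")
    case True
    moreover from that obtain i' where "i = Suc i'" by (cases i) auto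
    ultimately show ?thesis by (simp add: part_def)
  next
    case False
    then have "f i = 0" using anti[of "Suc l" i] l0 by simp
    then show ?thesis using False by (simp add: part_def)
  qed
  ultimately show thesis by (rule that)
qed

lemma contained_refl [simp]: "contained lam lam"
  by (simp add: contained_def)

lemma contained_trans: "contained lam mu \<Longrightarrow> contained mu nu \<Longrightarrow> contained lam nu"
  unfolding contained_def by (meson order_trans)

lemma contained_sum_le:
  assumes "contained mu lam"
  shows "sum_list mu \<le> sum_list lam"
proof -
  let ?M = "max (length mu) (length lam)"
  have "(\<Sum>i=1..?M. part mu i) \<le> (\<Sum>i=1..?M. part lam i)"
    using assms by (intro sum_mono) (auto simp: contained_def)
  then show ?thesis by (simp add: sum_list_eq_sum_part[of _ ?M])
qed

lemma contained_sum_eq: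
  assumes "is_partition lam" "is_partition mu" "contained mu lam" "sum_list lam \<le> sum_list mu"
  shows "lam = mu"
proof (rule partition_eqI[OF assms(1,2)])
  let ?M = "max (length mu) (length lam)"
  fix i :: nat assume i: "1 \<le> i"
  have eq: "(\<Sum>i=1..?M. part mu i) = (\<Sum>i=1..?M. part lam i)"
    using assms(4) contained_sum_le[OF assms(3)] by (simp add: sum_list_eq_sum_part[of _ ?M])
  show "part lam i = part mu i"
  proof (cases "i \<le> ?M")
    case True
    have "(\<Sum>i=1..?M. part lam i - part mu i) = (\<Sum>i=1..?M. part lam i) - (\<Sum>i=1..?M. part mu i)"
      using assms(3) by (intro sum_subtractf_nat) (auto simp: contained_def)
    then have "\<forall>i\<in>{1..?M}. part lam i - part mu i = 0"
      using eq by simp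
    then show ?thesis using assms(3) i True by (force simp: contained_def intro: antisym)
  next
    case False
    then show ?thesis by (simp add: part_beyond_length)
  qed
qed

lemma mem_skew_diagram:
  "(i, j) \<in> skew_diagram lam mu \<longleftrightarrow> 1 \<le> i \<and> part mu i < j \<and> j \<le> part lam i"
  by (auto simp: skew_diagram_def part_def split: if_splits)

lemma card_skew_diagram:
  assumes "contained mu lam"
  shows "card (skew_diagram lam mu) = sum_list lam - sum_list mu"
proof -
  let ?M = "max (length mu) (length lam)"
  have "skew_diagram lam mu = (SIGMA i:{1..?M}. {part mu i<..part lam i})"
    by (auto simp: mem_skew_diagram part_def split: if_splits)
  then have "card (skew_diagram lam mu) = (\<Sum>i=1..?M. part lam i - part mu i)"
    by simp
  also have "\<dots> = (\<Sum>i=1..?M. part lam i) - (\<Sum>i=1..?M. part mu i)"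
    using assms by (intro sum_subtractf_nat) (auto simp: contained_def)
  finally show ?thesis by (simp add: sum_list_eq_sum_part[of _ ?M])
qed

text \<open>
  A skew shape has at most one cell in each column if and only if row \<open>i + 1\<close> of the outer shape never
  extends beyond row \<open>i\<close> of the inner shape.
\<close>

definition horizontal_strip :: "nat list \<Rightarrow> nat list \<Rightarrow> bool" where
  "horizontal_strip lam mu \<longleftrightarrow> contained mu lam \<and> (\<forall>i\<ge>1. part lam (Suc i) \<le> part mu i)"

definition vertical_strip :: "nat list \<Rightarrow> nat list \<Rightarrow> bool" where
  "vertical_strip lam mu \<longleftrightarrow> contained mu lam \<and> (\<forall>i\<ge>1. part lam i \<le> Suc (part mu i))"

text \<open>
  Every sum over partitions below is truncated to partitions of bounded size, so that all matrices
  indexed by partitions are finite and matrix multiplication is associative without any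
  convergence hypothesis.  A fixed monomial only sees finitely many shapes, so a large enough bound
  loses nothing.
\<close>

definition partitions_upto :: "nat \<Rightarrow> nat list set" where
  "partitions_upto N = {lam. is_partition lam \<and> sum_list lam \<le> N}"

lemma finite_partitions_upto [simp]: "finite (partitions_upto N)"
proof -
  have "partitions_upto N = (\<Union>n\<le>N. partitions_of n)"
    by (auto simp: partitions_upto_def partitions_of_def)
  then show ?thesis by simp
qed

section \<open>Components of broken ribbons\<close>

definition same_fibre :: "('a \<Rightarrow> 'b) \<Rightarrow> 'a set \<Rightarrow> ('a \<times> 'a) set" where
  "same_fibre f D = {(c, d). c \<in> D \<and> d \<in> D \<and> f c = f d}"

lemma card_quotient_same_fibre: "card (D // same_fibre f D) = card (f ` D)"
proof -
  have "D // same_fibre f D = (\<lambda>y. {c \<in> D. f c = y}) ` f ` D"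
    by (force simp: quotient_def same_fibre_def image_iff)
  moreover have "inj_on (\<lambda>y. {c \<in> D. f c = y}) (f ` D)"
    by (auto simp: inj_on_def)
  ultimately show ?thesis by (simp add: card_image)
qed

lemma equiv_linked: "equiv D (linked D)"
proof -
  let ?r = "{(a, b). a \<in> D \<and> b \<in> D \<and> adjacent a b}"
  have "sym ?r" by (auto simp: sym_def adjacent_def)
  then have "sym (?r\<^sup>*)" by (rule sym_rtrancl)
  show ?thesis
  proof (rule equivI)
    show "linked D \<subseteq> D \<times> D" "refl_on D (linked D)"
      by (auto simp: linked_def refl_on_def)
    show "sym (linked D)"
      using symD[OF \<open>sym (?r\<^sup>*)\<close>] by (simp add: sym_def linked_def)
    show "trans (linked D)"
    proof (rule transI)
      fix c d e assume "(c, d) \<in> linked D" "(d, e) \<in> linked D"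
      then show "(c, e) \<in> linked D"
        using rtrancl_trans[of c d ?r e] by (simp add: linked_def)
    qed
  qed
qed

text \<open>
  With \<open>g\<close> the row or the column of a cell, the left-hand sum is the height or the width of the
  diagram.  Distinct components occupy distinct rows and distinct columns, so both statistics are
  a global count of non-empty rows or columns minus the number of components.
\<close>

lemma sum_card_image_components:
  assumes "finite D" and fibres: "\<And>c d. c \<in> D \<Longrightarrow> d \<in> D \<Longrightarrow> g c = g d \<Longrightarrow> (c, d) \<in> linked D"
  shows "(\<Sum>R\<in>components D. card (g ` R) - 1) + card (components D) = card (g ` D)"
proof -
  note eq = equiv_linked[of D]
  have fin: "finite (components D)"
    unfolding components_def using assms(1) eq
    by (metis equiv_type finite_quotient)
  have un: "\<Union>(components D) = D"
    unfolding components_def by (rule Union_quotient[OF eq])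
  have finR: "finite R" and ne: "R \<noteq> {}" if "R \<in> components D" for R
    using that un assms(1) finite_subset[of R D] in_quotient_imp_non_empty[OF eq, of R]
    by (auto simp: components_def)
  have disj: "g ` R \<inter> g ` R' = {}"
    if R: "R \<in> components D" "R' \<in> components D" "R \<noteq> R'" for R R'
  proof (rule ccontr)
    assume "g ` R \<inter> g ` R' \<noteq> {}"
    then obtain c d where cd: "c \<in> R" "d \<in> R'" "g c = g d" by auto
    moreover have "c \<in> D" "d \<in> D" using cd R un by auto
    ultimately have "(c, d) \<in> linked D" using fibres by blast
    then have "R = R'"
      using R cd quotient_eq_iff[OF eq, of R R' c d] by (simp add: components_def)
    then show False using R by simp
  qed
  have "card (g ` D) = card (\<Union>R\<in>components D. g ` R)"
    using un by (metis image_Union)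
  also have "\<dots> = (\<Sum>R\<in>components D. card (g ` R))"
    using fin finR disj by (intro card_UN_disjoint) auto
  also have "\<dots> = (\<Sum>R\<in>components D. (card (g ` R) - 1) + 1)"
  proof (rule sum.cong)
    fix R assume "R \<in> components D"
    then have "card (g ` R) \<noteq> 0" using finR ne by auto
    then show "card (g ` R) = (card (g ` R) - 1) + 1" by simp
  qed simp
  finally show ?thesis by (simp only: sum.distrib) simp
qed

definition rows :: "nat list \<Rightarrow> nat list \<Rightarrow> nat set" where
  "rows rho lam = {i. 1 \<le> i \<and> part lam i < part rho i}"

text \<open>
  A row is attached if it shares a column with the row directly above it.  In a broken ribbon the
  shared column is unique, and each unattached non-empty row is the top row of one component.
\<close>

definition attached_rows :: "nat list \<Rightarrow> nat list \<Rightarrow> nat set" where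
  "attached_rows rho lam = {i \<in> rows rho lam. 1 < i \<and> part lam (i - 1) < part rho i}"

lemma finite_rows [simp]: "finite (rows rho lam)"
proof (rule finite_subset)
  show "rows rho lam \<subseteq> {..length rho}"
    by (auto simp: rows_def part_def split: if_splits)
qed simp

lemma attached_rows_subset: "attached_rows rho lam \<subseteq> rows rho lam"
  by (auto simp: attached_rows_def)

lemma finite_attached_rows [simp]: "finite (attached_rows rho lam)"
  using finite_subset[OF attached_rows_subset] by simp

lemma rows_eq_fst_image: "fst ` skew_diagram rho lam = rows rho lam"
proof (rule set_eqI)
  fix i
  show "i \<in> fst ` skew_diagram rho lam \<longleftrightarrow> i \<in> rows rho lam"
    by (auto simp: rows_def mem_skew_diagram image_iff intro!: bexI[of _ "(i, part rho i)"])
qed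

text \<open>
  A 2-by-2 block in rows \<open>i\<close>, \<open>i + 1\<close> exists as soon as these rows overlap in two columns; the
  leftmost candidate is the first cell of row \<open>i\<close>.
\<close>

lemma no_block_iff:
  assumes "is_partition rho" "is_partition lam"
  shows "\<not> has_2x2_block (skew_diagram rho lam)
    \<longleftrightarrow> (\<forall>i\<ge>1. part rho (Suc i) \<le> Suc (part lam i))"
proof -
  have "(\<exists>j. {(i, j), (i, Suc j), (Suc i, j), (Suc i, Suc j)} \<subseteq> skew_diagram rho lam)
      \<longleftrightarrow> 1 \<le> i \<and> Suc (part lam i) < part rho (Suc i)" (is "(\<exists>j. ?B j) \<longleftrightarrow> ?R") for i
  proof
    assume "\<exists>j. ?B j"
    then show ?R by (auto simp: mem_skew_diagram)
  next
    assume R: ?R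
    then have "part rho (Suc i) \<le> part rho i" "part lam (Suc i) \<le> part lam i"
      using part_Suc_le assms by auto
    then have "?B (Suc (part lam i))" using R by (auto simp: mem_skew_diagram)
    then show "\<exists>j. ?B j" ..
  qed
  then show ?thesis unfolding has_2x2_block_def by (auto simp: not_less)
qed

text \<open>
  Following attached rows upwards leads to the top row of the component, which serves as a
  canonical name for the component.
\<close>

primrec top_row :: "nat list \<Rightarrow> nat list \<Rightarrow> nat \<Rightarrow> nat" where
  "top_row rho lam 0 = 0"
| "top_row rho lam (Suc i) =
     (if Suc i \<in> attached_rows rho lam then top_row rho lam i else Suc i)"

lemma pred_of_attached_row:
  assumes "is_partition rho" "Suc i \<in> attached_rows rho lam"
  shows "i \<in> rows rho lam"
    and "(i, part rho (Suc i)) \<in> skew_diagram rho lam"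
    and "(Suc i, part rho (Suc i)) \<in> skew_diagram rho lam"
  using assms part_Suc_le[of rho i]
  by (auto simp: attached_rows_def rows_def mem_skew_diagram)

lemma top_row_in_free_rows:
  assumes "is_partition rho" "i \<in> rows rho lam"
  shows "top_row rho lam i \<in> rows rho lam - attached_rows rho lam"
  using assms(2)
proof (induction i)
  case (Suc i)
  then show ?case using pred_of_attached_row[OF assms(1), of i lam] by auto
qed (simp add: rows_def)

lemma top_row_of_free_row:
  assumes "i \<notin> attached_rows rho lam"
  shows "top_row rho lam i = i"
  using assms by (cases i) auto

lemma top_row_image:
  assumes "is_partition rho"
  shows "top_row rho lam ` rows rho lam = rows rho lam - attached_rows rho lam"
  using top_row_in_free_rows[OF assms] top_row_of_free_row
  by (auto simp: image_iff) (metis Diff_iff)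

lemma linked_refl: "c \<in> D \<Longrightarrow> (c, c) \<in> linked D"
  by (simp add: linked_def)

lemma linked_sym: "(c, d) \<in> linked D \<Longrightarrow> (d, c) \<in> linked D"
  using equiv_linked[of D] by (meson equivE symD)

lemma linked_trans: "(c, d) \<in> linked D \<Longrightarrow> (d, e) \<in> linked D \<Longrightarrow> (c, e) \<in> linked D"
  using equiv_linked[of D] by (meson equivE transD)

lemma linked_adjacent: "c \<in> D \<Longrightarrow> d \<in> D \<Longrightarrow> adjacent c d \<Longrightarrow> (c, d) \<in> linked D"
  by (auto simp: linked_def)

lemma linked_same_row:
  assumes "(i, j) \<in> skew_diagram rho lam" "(i, j') \<in> skew_diagram rho lam"
  shows "((i, j), (i, j')) \<in> linked (skew_diagram rho lam)"
proof -
  have *: "((i, j), (i, j')) \<in> linked (skew_diagram rho lam)"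
    if "j \<le> j'" "(i, j) \<in> skew_diagram rho lam" "(i, j') \<in> skew_diagram rho lam" for j j'
    using that
  proof (induction rule: dec_induct)
    case (step n)
    then have "(i, n) \<in> skew_diagram rho lam" by (auto simp: mem_skew_diagram)
    moreover have "((i, n), (i, Suc n)) \<in> linked (skew_diagram rho lam)"
      using calculation step by (intro linked_adjacent) (auto simp: adjacent_def)
    ultimately show ?case using step by (metis linked_trans)
  qed (simp add: linked_refl)
  show ?thesis using *[of j j'] *[of j' j] assms linked_sym nat_le_linear by blast
qed

lemma linked_top_row:
  assumes "is_partition rho" "(i, j) \<in> skew_diagram rho lam"
  shows "\<exists>j'. ((i, j), (top_row rho lam i, j')) \<in> linked (skew_diagram rho lam)"
  using assms(2)
proof (induction i arbitrary: j)
  case 0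
  then show ?case by (simp add: mem_skew_diagram)
next
  case (Suc i)
  show ?case
  proof (cases "Suc i \<in> attached_rows rho lam")
    case True
    let ?m = "part rho (Suc i)"
    note p = pred_of_attached_row[OF assms(1) True]
    obtain j' where "((i, ?m), (top_row rho lam i, j')) \<in> linked (skew_diagram rho lam)"
      using Suc.IH[OF p(2)] by blast
    moreover have "((Suc i, ?m), (i, ?m)) \<in> linked (skew_diagram rho lam)"
      using p by (intro linked_adjacent) (auto simp: adjacent_def)
    moreover have "((Suc i, j), (Suc i, ?m)) \<in> linked (skew_diagram rho lam)"
      using Suc.prems p by (intro linked_same_row)
    ultimately have "((Suc i, j), (top_row rho lam i, j')) \<in> linked (skew_diagram rho lam)"
      by (metis linked_trans)
    then show ?thesis using True by auto
  next
    case False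
    then show ?thesis using Suc.prems linked_refl by auto
  qed
qed

text \<open>
  An edge between two adjacent cells never changes the top row, and conversely every cell can be
  walked up to the top row of its component.
\<close>

lemma linked_eq_same_top_row:
  assumes "is_partition rho"
  shows "linked (skew_diagram rho lam)
    = same_fibre (\<lambda>c. top_row rho lam (fst c)) (skew_diagram rho lam)"
    (is "linked ?D = _")
proof (intro set_eqI iffI)
  have step: "top_row rho lam (fst c) = top_row rho lam (fst d)"
    if "c \<in> ?D" "d \<in> ?D" "adjacent c d" for c d
    using that
    by (cases c; cases d) (auto simp: adjacent_def mem_skew_diagram attached_rows_def rows_def)
  fix p assume "p \<in> linked ?D"
  then obtain c d where p: "p = (c, d)" "c \<in> ?D" "d \<in> ?D"
    and "(c, d) \<in> {(a, b). a \<in> ?D \<and> b \<in> ?D \<and> adjacent a b}\<^sup>*"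
    by (auto simp: linked_def)
  from this(4) have "top_row rho lam (fst c) = top_row rho lam (fst d)"
    by (induction rule: rtrancl_induct) (use step in auto)
  then show "p \<in> same_fibre (\<lambda>c. top_row rho lam (fst c)) ?D"
    using p by (simp add: same_fibre_def)
next
  fix p assume "p \<in> same_fibre (\<lambda>c. top_row rho lam (fst c)) ?D"
  then obtain i j i' j' where p: "p = ((i, j), (i', j'))" "(i, j) \<in> ?D" "(i', j') \<in> ?D"
    and top: "top_row rho lam i = top_row rho lam i'"
    by (auto simp: same_fibre_def)
  obtain k where k: "((i, j), (top_row rho lam i, k)) \<in> linked ?D"
    using linked_top_row[OF assms p(2)] by blast
  obtain k' where k': "((i', j'), (top_row rho lam i, k')) \<in> linked ?D"
    using linked_top_row[OF assms p(3)] top by auto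
  have "((top_row rho lam i, k), (top_row rho lam i, k')) \<in> linked ?D"
    using k k' by (intro linked_same_row) (auto simp: linked_def)
  then show "p \<in> linked ?D"
    using p k k' linked_trans linked_sym by metis
qed

lemma rib_eq_card_free_rows:
  assumes "is_partition rho"
  shows "rib rho lam = card (rows rho lam - attached_rows rho lam)"
proof -
  have "rib rho lam = card ((\<lambda>c. top_row rho lam (fst c)) ` skew_diagram rho lam)"
    by (simp add: rib_def components_def linked_eq_same_top_row[OF assms] card_quotient_same_fibre)
  also have "(\<lambda>c. top_row rho lam (fst c)) ` skew_diagram rho lam = top_row rho lam ` rows rho lam"
    by (simp add: rows_eq_fst_image[symmetric] image_image)
  finally show ?thesis by (simp add: top_row_image[OF assms])
qed

lemma card_attached_plus_rib:
  assumes "is_partition rho"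
  shows "card (attached_rows rho lam) + rib rho lam = card (rows rho lam)"
proof -
  have "card (rows rho lam - attached_rows rho lam) = card (rows rho lam) - card (attached_rows rho lam)"
    by (intro card_Diff_subset) (auto simp: attached_rows_subset)
  moreover have "card (attached_rows rho lam) \<le> card (rows rho lam)"
    by (intro card_mono attached_rows_subset) simp
  ultimately show ?thesis by (simp add: rib_eq_card_free_rows[OF assms])
qed

lemma ht_eq_card_attached_rows:
  assumes "is_partition rho"
  shows "ht rho lam = card (attached_rows rho lam)"
proof -
  have "ht rho lam + rib rho lam = card (fst ` skew_diagram rho lam)"
    unfolding ht_def rib_def
    by (rule sum_card_image_components) (auto intro!: linked_same_row)
  then show ?thesis
    using card_attached_plus_rib[OF assms, of lam] by (simp add: rows_eq_fst_image)
qed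

lemma linked_same_column:
  assumes "is_partition rho" "is_partition lam"
    and "(i, j) \<in> skew_diagram rho lam" "(i', j) \<in> skew_diagram rho lam"
  shows "((i, j), (i', j)) \<in> linked (skew_diagram rho lam)"
proof -
  have *: "((i, j), (i', j)) \<in> linked (skew_diagram rho lam)"
    if "i \<le> i'" "(i, j) \<in> skew_diagram rho lam" "(i', j) \<in> skew_diagram rho lam" for i i'
    using that
  proof (induction rule: dec_induct)
    case (step n)
    then have "part lam n \<le> part lam i" "part rho (Suc n) \<le> part rho n"
      using part_antimono[of lam i n] part_Suc_le[of rho n] assms(1,2)
      by (auto simp: mem_skew_diagram)
    then have "(n, j) \<in> skew_diagram rho lam"
      using step by (auto simp: mem_skew_diagram)
    moreover have "((n, j), (Suc n, j)) \<in> linked (skew_diagram rho lam)"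
      using calculation step by (intro linked_adjacent) (auto simp: adjacent_def)
    ultimately show ?case using step by (metis linked_trans)
  qed (simp add: linked_refl)
  show ?thesis using *[of i i'] *[of i' i] assms linked_sym nat_le_linear by blast
qed

text \<open>
  Each column contains exactly one topmost cell.  A cell that is not topmost lies in an attached row,
  and the absence of a block forces it to be the last cell of that row.
\<close>

lemma card_columns:
  assumes "is_partition rho" "is_partition lam"
    and no_block: "\<And>i. 1 \<le> i \<Longrightarrow> part rho (Suc i) \<le> Suc (part lam i)"
  shows "card (snd ` skew_diagram rho lam) + card (attached_rows rho lam)
    = card (skew_diagram rho lam)"
proof -
  let ?D = "skew_diagram rho lam"
  let ?top = "{(i, j) \<in> ?D. (i - 1, j) \<notin> ?D}"
  let ?below = "{(i, j) \<in> ?D. (i - 1, j) \<in> ?D}"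
  have "snd ` ?top = snd ` ?D"
  proof (intro equalityI subsetI)
    fix j assume "j \<in> snd ` ?D"
    then obtain i where "(i, j) \<in> ?D" by auto
    then show "j \<in> snd ` ?top"
    proof (induction i)
      case (Suc i)
      show ?case
      proof (cases "(i, j) \<in> ?D")
        case False
        then have "(Suc i, j) \<in> ?top" using Suc.prems by auto
        then show ?thesis by force
      qed (use Suc.IH in auto)
    qed (simp add: mem_skew_diagram)
  qed auto
  moreover have inj: "inj_on snd ?top"
  proof -
    have below: "i' \<le> i" if ij: "(i, j) \<in> ?D" and i'j: "(i', j) \<in> ?top" for i i' j
    proof (rule ccontr)
      assume "\<not> i' \<le> i"
      then have "i \<le> i' - 1" "1 \<le> i' - 1" using ij by (auto simp: mem_skew_diagram)
      moreover have "part lam (i' - 1) \<le> part lam i" "part rho i' \<le> part rho (i' - 1)"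
        using part_antimono[OF assms(2), of i "i' - 1"] part_antimono[OF assms(1), of "i' - 1" i']
          ij calculation by (auto simp: mem_skew_diagram)
      ultimately have "(i' - 1, j) \<in> ?D"
        using ij i'j by (auto simp: mem_skew_diagram)
      then show False using i'j by simp
    qed
    have "i = i'" if "(i, j) \<in> ?top" "(i', j) \<in> ?top" for i i' j
    proof (rule antisym)
      show "i \<le> i'" using below[of i' j i] that by auto
      show "i' \<le> i" using below[of i j i'] that by auto
    qed
    then show ?thesis by (auto simp: inj_on_def)
  qed
  ultimately have top: "card (snd ` ?D) = card ?top"
    using card_image[OF inj] by simp
  have "bij_betw fst ?below (attached_rows rho lam)"
  proof (rule bij_betwI[where g = "\<lambda>i. (i, part rho i)"])
    show "fst \<in> ?below \<rightarrow> attached_rows rho lam"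
      by (auto simp: attached_rows_def rows_def mem_skew_diagram)
    show "(\<lambda>i. (i, part rho i)) \<in> attached_rows rho lam \<rightarrow> ?below"
    proof
      fix i assume i: "i \<in> attached_rows rho lam"
      then obtain i' where "i = Suc i'" by (cases i) (auto simp: attached_rows_def)
      then show "(i, part rho i) \<in> ?below"
        using pred_of_attached_row[OF assms(1), of i' lam] i by simp
    qed
    show "(fst c, part rho (fst c)) = c" if mem: "c \<in> ?below" for c
    proof -
      obtain i j where c: "c = (i, j)" "(i, j) \<in> ?D" "(i - 1, j) \<in> ?D"
        using mem by (cases c) auto
      then have "part rho i \<le> Suc (part lam (i - 1))"
        using no_block[of "i - 1"] by (auto simp: mem_skew_diagram)
      then show ?thesis using c by (auto simp: mem_skew_diagram)
    qed
  qed auto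
  then have "card ?below = card (attached_rows rho lam)" by (rule bij_betw_same_card)
  moreover have "card ?D = card (?top \<union> ?below)" by (rule arg_cong[of _ _ card]) auto
  moreover have "card (?top \<union> ?below) = card ?top + card ?below"
    by (rule card_Un_disjoint) (auto intro: finite_subset[of _ ?D])
  ultimately show ?thesis using top by simp
qed

text \<open>
  A single ribbon with \<open>h\<close> rows and \<open>w\<close> columns has \<open>h + w - 1\<close> cells; this is the sum of that count
  over the components.
\<close>

lemma size_eq_wt_ht_rib:
  assumes "is_partition rho" "is_partition lam" "is_broken_ribbon rho lam"
  shows "sum_list rho = sum_list lam + wt rho lam + ht rho lam + rib rho lam"
proof -
  have "wt rho lam + rib rho lam = card (snd ` skew_diagram rho lam)"
    unfolding wt_def rib_def
    by (rule sum_card_image_components) (use assms(1,2) in \<open>auto intro!: linked_same_column\<close>)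
  moreover have "card (snd ` skew_diagram rho lam) + card (attached_rows rho lam)
      = card (skew_diagram rho lam)"
    using assms by (intro card_columns) (auto simp: is_broken_ribbon_def no_block_iff)
  moreover have "card (skew_diagram rho lam) = sum_list rho - sum_list lam"
    "sum_list lam \<le> sum_list rho"
    using assms(3) by (simp_all add: is_broken_ribbon_def card_skew_diagram contained_sum_le)
  ultimately show ?thesis
    using ht_eq_card_attached_rows[OF assms(1), of lam] by linarith
qed

section \<open>Cutting a broken ribbon into two strips\<close>

definition strip_between :: "nat list \<Rightarrow> nat list \<Rightarrow> nat list set" where
  "strip_between rho lam =
     {nu. is_partition nu \<and> horizontal_strip nu lam \<and> vertical_strip rho nu}"

lemma strip_between_imp_broken_ribbon:
  assumes "nu \<in> strip_between rho lam" "is_partition rho" "is_partition lam"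
  shows "is_broken_ribbon rho lam"
proof -
  have "part rho (Suc i) \<le> Suc (part lam i)" if "1 \<le> i" for i
    using assms(1) that le_trans[of "part rho (Suc i)" "Suc (part nu (Suc i))"]
    by (auto simp: strip_between_def horizontal_strip_def vertical_strip_def)
  then show ?thesis
    using assms by (auto simp: is_broken_ribbon_def no_block_iff strip_between_def
        horizontal_strip_def vertical_strip_def intro: contained_trans)
qed

lemma attached_row_le:
  assumes "nu \<in> strip_between rho lam" "i \<in> attached_rows rho lam"
  shows "part nu i \<le> part lam (i - 1)"
proof -
  obtain i' where "i = Suc i'" "1 \<le> i'"
    using assms(2) by (cases i) (auto simp: attached_rows_def)
  then show ?thesis
    using assms(1) by (simp add: strip_between_def horizontal_strip_def)
qed

text \<open>
  An intermediate shape removes from each row of \<open>rho / lam\<close> either nothing or its last cell.  In an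
  attached row the last cell must be removed, because otherwise it would sit below a cell of the
  horizontal strip; in every other non-empty row the choice is free.
\<close>

lemma bij_betw_strip_between:
  assumes "is_partition rho" "is_partition lam" "is_broken_ribbon rho lam"
  shows "bij_betw (\<lambda>nu. {i. 1 \<le> i \<and> part nu i < part rho i} - attached_rows rho lam)
    (strip_between rho lam) (Pow (rows rho lam - attached_rows rho lam))"
    (is "bij_betw ?f ?V ?P")
proof -
  let ?A = "attached_rows rho lam" and ?R = "rows rho lam"
  have no_block: "part rho (Suc i) \<le> Suc (part lam i)" if "1 \<le> i" for i
    using assms that by (auto simp: is_broken_ribbon_def no_block_iff)
  have le: "part lam i \<le> part rho i" if "1 \<le> i" for i
    using assms(3) that by (simp add: is_broken_ribbon_def contained_def)
  have drop: "part nu i = part rho i - (if i \<in> ?A \<union> ?f nu then 1 else 0)"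
    if nu: "nu \<in> ?V" and i: "1 \<le> i" for nu i
  proof -
    have 1: "part nu i \<le> part rho i" "part rho i \<le> Suc (part nu i)"
      using nu i by (auto simp: strip_between_def vertical_strip_def contained_def)
    have 2: "part nu i < part rho i" if "i \<in> ?A"
      using attached_row_le[OF nu that] that by (auto simp: attached_rows_def)
    show ?thesis using 1 2 i by auto
  qed
  have inj: "inj_on ?f ?V"
  proof (rule inj_onI)
    fix nu nu' assume nu: "nu \<in> ?V" "nu' \<in> ?V" and eq: "?f nu = ?f nu'"
    show "nu = nu'"
    proof (rule partition_eqI)
      fix i :: nat assume i: "1 \<le> i"
      have "part nu i = part rho i - (if i \<in> ?A \<union> ?f nu then 1 else 0)"
        by (rule drop[OF nu(1) i])
      also have "\<dots> = part rho i - (if i \<in> ?A \<union> ?f nu' then 1 else 0)"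
        by (simp only: eq)
      also have "\<dots> = part nu' i" by (rule drop[OF nu(2) i, symmetric])
      finally show "part nu i = part nu' i" .
    qed (use nu in \<open>auto simp: strip_between_def\<close>)
  qed
  have "?f ` ?V = ?P"
  proof (intro equalityI subsetI)
    fix X assume "X \<in> ?f ` ?V"
    then obtain nu where nu: "nu \<in> ?V" "X = ?f nu" by auto
    have "part lam i \<le> part nu i" if "1 \<le> i" for i
      using nu that by (auto simp: strip_between_def horizontal_strip_def contained_def)
    then show "X \<in> ?P" using nu(2) by (auto simp: rows_def intro: le_less_trans)
  next
    fix X assume X: "X \<in> ?P"
    \<comment> \<open>the shape that drops the last cell of the attached rows and of the rows chosen in \<open>X\<close>\<close>
    define g where "g i = part rho i - (if i \<in> ?A \<union> X then 1 else 0)" for i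
    have XR: "?A \<union> X \<subseteq> ?R" using X attached_rows_subset by auto
    have g_ge: "part lam i \<le> g i" if "1 \<le> i" for i
      using XR le[OF that] by (auto simp: g_def rows_def)
    have g_le: "g i \<le> part rho i" "part rho i \<le> Suc (g i)" for i by (auto simp: g_def)
    have strip: "g (Suc i) \<le> part lam i" if "1 \<le> i" for i
    proof (cases "Suc i \<in> ?A")
      case True
      then show ?thesis using no_block[OF that] by (simp add: g_def)
    next
      case False
      have "part rho (Suc i) \<le> part lam i"
        using False that part_Suc_le[OF assms(2) that] le[of "Suc i"]
        by (auto simp: attached_rows_def rows_def not_less)
      then show ?thesis using g_le(1)[of "Suc i"] by linarith
    qed
    obtain nu where nu: "is_partition nu" "\<And>i. 1 \<le> i \<Longrightarrow> part nu i = g i"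
    proof (rule partition_from_parts)
      show "g (Suc i) \<le> g i" if "1 \<le> i" for i
        using strip[OF that] g_ge[OF that] by linarith
      show "g (Suc (length rho)) = 0" by (simp add: g_def part_def)
    qed (rule that, assumption, blast)
    have "nu \<in> ?V"
      using nu g_ge g_le strip
      by (auto simp: strip_between_def horizontal_strip_def vertical_strip_def contained_def)
    moreover have "?f nu = X"
    proof -
      have "{i. 1 \<le> i \<and> g i < part rho i} = ?A \<union> X"
        using XR by (auto simp: g_def rows_def)
      then show ?thesis using nu X by (auto cong: conj_cong)
    qed
    ultimately show "X \<in> ?f ` ?V" by blast
  qed
  with inj show ?thesis by (simp add: bij_betw_def)
qed

lemma strip_between_size:
  assumes "nu \<in> strip_between rho lam"
  shows "sum_list rho = sum_list nu + card {i. 1 \<le> i \<and> part nu i < part rho i}"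
proof -
  have vs: "vertical_strip rho nu" using assms by (simp add: strip_between_def)
  have "bij_betw fst (skew_diagram rho nu) (rows rho nu)"
  proof (rule bij_betwI[where g = "\<lambda>i. (i, part rho i)"])
    show "fst \<in> skew_diagram rho nu \<rightarrow> rows rho nu"
      using rows_eq_fst_image[of rho nu] by auto
    show "(fst c, part rho (fst c)) = c" if mem: "c \<in> skew_diagram rho nu" for c
    proof -
      obtain i j where c: "c = (i, j)" "1 \<le> i" "part nu i < j" "j \<le> part rho i"
        using mem by (cases c) (auto simp: mem_skew_diagram)
      moreover have "part rho i \<le> Suc (part nu i)"
        using vs c by (auto simp: vertical_strip_def)
      ultimately show ?thesis by simp
    qed
  qed (auto simp: rows_def mem_skew_diagram)
  then have "card (skew_diagram rho nu) = card (rows rho nu)" by (rule bij_betw_same_card)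
  then show ?thesis
    using vs contained_sum_le[of nu rho]
    by (simp add: card_skew_diagram vertical_strip_def rows_def)
qed

definition ribbon_weight :: "'a::comm_ring_1 \<Rightarrow> 'a \<Rightarrow> nat list \<Rightarrow> nat list \<Rightarrow> 'a" where
  "ribbon_weight a b lam rho =
     (if is_broken_ribbon rho lam
      then a ^ wt rho lam * b ^ ht rho lam * (a + b) ^ rib rho lam else 0)"

text \<open>
  The last cell of an attached row contributes \<open>b\<close>, the last cell of a top row contributes \<open>a + b\<close>,
  and all other cells contribute \<open>a\<close>.  Attached rows are counted by the height and top rows by the
  number of components, which leaves the width for the remaining cells.
\<close>

lemma sum_strip_between:
  fixes a b :: "'a::comm_ring_1"
  assumes "is_partition rho" "is_partition lam"
  shows "(\<Sum>nu\<in>strip_between rho lam.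
      a ^ (sum_list nu - sum_list lam) * b ^ (sum_list rho - sum_list nu)) = ribbon_weight a b lam rho"
proof (cases "is_broken_ribbon rho lam")
  case False
  then have "strip_between rho lam = {}" using strip_between_imp_broken_ribbon assms by blast
  then show ?thesis using False by (simp add: ribbon_weight_def)
next
  case True
  let ?A = "attached_rows rho lam"
  let ?F = "rows rho lam - attached_rows rho lam"
  let ?f = "\<lambda>nu. {i. 1 \<le> i \<and> part nu i < part rho i} - ?A"
  note bij = bij_betw_strip_between[OF assms True]
  have size: "sum_list rho = sum_list lam + wt rho lam + ht rho lam + rib rho lam"
    by (rule size_eq_wt_ht_rib(1)[OF assms True])
  have "(\<Sum>nu\<in>strip_between rho lam.
      a ^ (sum_list nu - sum_list lam) * b ^ (sum_list rho - sum_list nu))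
    = (\<Sum>nu\<in>strip_between rho lam. a ^ wt rho lam * b ^ ht rho lam *
        (a ^ card (?F - ?f nu) * b ^ card (?f nu)))"
  proof (rule sum.cong)
    fix nu assume nu: "nu \<in> strip_between rho lam"
    let ?B = "{i. 1 \<le> i \<and> part nu i < part rho i}"
    have fF: "?f nu \<subseteq> ?F" using bij_betw_apply[OF bij nu] by blast
    then have finf: "finite (?f nu)" by (rule finite_subset) simp
    have A: "?A \<subseteq> ?B"
    proof
      fix i assume i: "i \<in> ?A"
      then show "i \<in> ?B" using attached_row_le[OF nu i] by (auto simp: attached_rows_def)
    qed
    then have "?B = ?A \<union> ?f nu" by auto
    then have "card ?B = card ?A + card (?f nu)"
      using finf by (metis Diff_disjoint card_Un_disjoint finite_attached_rows)
    then have "sum_list rho = sum_list nu + ht rho lam + card (?f nu)"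
      using strip_between_size[OF nu] by (simp add: ht_eq_card_attached_rows[OF assms(1)])
    moreover have "card (?F - ?f nu) = rib rho lam - card (?f nu)"
      using fF finf by (simp add: card_Diff_subset rib_eq_card_free_rows[OF assms(1)])
    moreover have "card (?f nu) \<le> rib rho lam"
      using card_mono[OF _ fF] by (simp add: rib_eq_card_free_rows[OF assms(1)])
    ultimately have "sum_list nu - sum_list lam = wt rho lam + card (?F - ?f nu)"
      "sum_list rho - sum_list nu = ht rho lam + card (?f nu)"
      using size by linarith+
    then show "a ^ (sum_list nu - sum_list lam) * b ^ (sum_list rho - sum_list nu)
        = a ^ wt rho lam * b ^ ht rho lam * (a ^ card (?F - ?f nu) * b ^ card (?f nu))"
      by (simp add: power_add mult_ac)
  qed simp
  also have "\<dots> = a ^ wt rho lam * b ^ ht rho lam *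
      (\<Sum>nu\<in>strip_between rho lam. a ^ card (?F - ?f nu) * b ^ card (?f nu))"
    by (simp add: sum_distrib_left)
  also have "(\<Sum>nu\<in>strip_between rho lam. a ^ card (?F - ?f nu) * b ^ card (?f nu))
      = (\<Sum>X\<in>Pow ?F. a ^ card (?F - X) * b ^ card X)"
    by (rule sum.reindex_bij_betw[OF bij])
  also have "\<dots> = (\<Prod>i\<in>?F. b + a)"
    by (subst prod_add) (auto intro!: sum.cong simp: mult.commute)
  also have "\<dots> = (a + b) ^ rib rho lam"
    by (simp add: rib_eq_card_free_rows[OF assms(1)] add.commute)
  finally show ?thesis using True by (simp add: ribbon_weight_def)
qed

lemma rib_eq_0_iff:
  assumes "is_partition rho" "is_partition lam" "is_broken_ribbon rho lam"
  shows "rib rho lam = 0 \<longleftrightarrow> rho = lam"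
proof
  assume "rib rho lam = 0"
  then have F: "rows rho lam \<subseteq> attached_rows rho lam"
    using rib_eq_card_free_rows[OF assms(1), of lam] by simp
  have "rows rho lam = {}"
  proof (rule ccontr)
    assume "rows rho lam \<noteq> {}"
    then obtain i where "i \<in> rows rho lam" by auto
    then show False using top_row_in_free_rows[OF assms(1)] F by auto
  qed
  then have "skew_diagram rho lam = {}" by (simp add: rows_eq_fst_image[symmetric])
  moreover have c: "contained lam rho" using assms(3) by (simp add: is_broken_ribbon_def)
  ultimately have "sum_list rho \<le> sum_list lam" using card_skew_diagram[OF c] by simp
  then show "rho = lam" by (intro contained_sum_eq[OF assms(1,2) c])
next
  assume "rho = lam"
  then show "rib rho lam = 0" using rib_eq_card_free_rows[OF assms(1), of lam] by (simp add: rows_def)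
qed

text \<open>
  For \<open>b = - a\<close> every component contributes the factor zero, so only the empty shape survives.  This
  is the identity \<open>H(t) E(- t) = 1\<close> in terms of strips.
\<close>

lemma ribbon_weight_cancel:
  assumes "is_partition rho" "is_partition lam"
  shows "ribbon_weight a (- a) lam rho = (if lam = rho then 1 else 0)"
proof (cases "is_broken_ribbon rho lam")
  case True
  then show ?thesis
    using rib_eq_0_iff[OF assms True] size_eq_wt_ht_rib(1)[OF assms True]
    by (auto simp: ribbon_weight_def power_0_left)
next
  case False
  moreover have "is_broken_ribbon rho rho" using assms(1)
    by (auto simp: is_broken_ribbon_def has_2x2_block_def mem_skew_diagram)
  ultimately show ?thesis by (auto simp: ribbon_weight_def)
qed

section \<open>Horizontal strips over and under a pair of partitions\<close>

text \<open>
  Write \<open>lo i\<close> and \<open>hi i\<close> for the larger and the smaller of the two \<open>i\<close>-th parts.  For an upper shape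
  \<open>rho\<close> the part \<open>rho (i + 1)\<close> ranges over the interval from \<open>lo (i + 1)\<close> to \<open>hi i\<close>, and for a lower
  shape \<open>nu\<close> the part \<open>nu i\<close> ranges over the same interval.  Reflecting each interval is therefore a
  bijection, up to the first part of \<open>rho\<close>, which is bounded only from below; its excess over \<open>lo 1\<close> is
  determined by the sizes and accounts for the inequality on the right.
\<close>

lemma common_horizontal_strips:
  assumes lam: "is_partition lam" and kap: "is_partition kap"
  shows "card {rho. is_partition rho \<and> horizontal_strip rho lam \<and> horizontal_strip rho kap \<and>
            sum_list rho = sum_list kap + k}
       = card {nu. is_partition nu \<and> horizontal_strip lam nu \<and> horizontal_strip kap nu \<and>
            sum_list lam \<le> sum_list nu + k}"
    (is "card ?X = card ?Y")
proof -
  define lo where "lo i = max (part lam i) (part kap i)" for i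
  define hi where "hi i = min (part lam i) (part kap i)" for i
  define M where "M = Suc (length lam + length kap)"
  have X_iff: "rho \<in> ?X \<longleftrightarrow> is_partition rho \<and> lo 1 \<le> part rho 1 \<and>
      (\<forall>i\<ge>1. lo (Suc i) \<le> part rho (Suc i) \<and> part rho (Suc i) \<le> hi i) \<and>
      sum_list rho = sum_list kap + k" for rho
  proof -
    have "(\<forall>i\<ge>1. lo i \<le> part rho i) \<longleftrightarrow> lo 1 \<le> part rho 1 \<and> (\<forall>i\<ge>1. lo (Suc i) \<le> part rho (Suc i))"
    proof (intro iffI conjI allI impI)
      fix i :: nat assume "lo 1 \<le> part rho 1 \<and> (\<forall>i\<ge>1. lo (Suc i) \<le> part rho (Suc i))" "1 \<le> i"
      then show "lo i \<le> part rho i"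
        by (cases i; cases "i - 1") auto
    qed auto
    moreover have "(\<forall>i\<ge>1. lo i \<le> part rho i) \<longleftrightarrow> contained lam rho \<and> contained kap rho"
      by (auto simp: contained_def lo_def)
    moreover have "(\<forall>i\<ge>1. part rho (Suc i) \<le> hi i) \<longleftrightarrow>
      (\<forall>i\<ge>1. part rho (Suc i) \<le> part lam i) \<and> (\<forall>i\<ge>1. part rho (Suc i) \<le> part kap i)"
      by (auto simp: hi_def)
    ultimately show ?thesis unfolding horizontal_strip_def by blast
  qed
  have Y_iff: "nu \<in> ?Y \<longleftrightarrow> is_partition nu \<and>
      (\<forall>i\<ge>1. lo (Suc i) \<le> part nu i \<and> part nu i \<le> hi i) \<and>
      sum_list lam \<le> sum_list nu + k" for nu
    unfolding horizontal_strip_def contained_def lo_def hi_def by auto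
  have hi_M: "hi i = 0" if "M \<le> i" for i
    using that by (simp add: hi_def M_def part_beyond_length)
  have sums: "sum_list lam + sum_list kap = lo 1 + (\<Sum>i=1..M. hi i + lo (Suc i))"
  proof -
    have "sum_list lam + sum_list kap = (\<Sum>i=1..Suc M. part lam i + part kap i)"
      by (simp add: sum_list_eq_sum_part[of lam "Suc M"] sum_list_eq_sum_part[of kap "Suc M"]
          M_def sum.distrib del: sum.cl_ivl_Suc)
    also have "\<dots> = (\<Sum>i=1..Suc M. lo i + hi i)"
      by (intro sum.cong) (auto simp: lo_def hi_def)
    also have "\<dots> = (\<Sum>i=1..Suc M. lo i) + (\<Sum>i=1..M. hi i)"
      by (simp add: sum.distrib hi_M)
    also have "(\<Sum>i=1..Suc M. lo i) = lo 1 + (\<Sum>i=1..M. lo (Suc i))"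
      by (simp add: sum.atLeast_Suc_atMost sum.atLeast_Suc_atMost_Suc_shift del: sum.cl_ivl_Suc)
    finally show ?thesis by (simp add: sum.distrib)
  qed
  have size_rho: "sum_list rho = part rho 1 + (\<Sum>i=1..M. part rho (Suc i))"
    if "is_partition rho" "\<And>i. 1 \<le> i \<Longrightarrow> part rho (Suc i) \<le> hi i" for rho
  proof -
    have "length rho \<le> M"
      using part_eq_0_iff[OF that(1), of "Suc M"] that(2)[of M] hi_M[of M] by (simp add: M_def)
    then have "sum_list rho = (\<Sum>i=1..Suc M. part rho i)" by (intro sum_list_eq_sum_part) simp
    then show ?thesis
      by (simp add: sum.atLeast_Suc_atMost sum.atLeast_Suc_atMost_Suc_shift del: sum.cl_ivl_Suc)
  qed
  have size_nu: "sum_list nu = (\<Sum>i=1..M. part nu i)"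
    if "is_partition nu" "\<And>i. 1 \<le> i \<Longrightarrow> part nu i \<le> hi i" for nu
  proof -
    have "length nu \<le> M"
      using part_eq_0_iff[OF that(1), of M] that(2)[of M] hi_M[of M] by (simp add: M_def)
    then show ?thesis by (rule sum_list_eq_sum_part)
  qed
  \<comment> \<open>\<open>nu\<close> is the reflection of \<open>rho\<close>, stated without subtraction so that it reads both ways\<close>
  define R where "R rho nu \<longleftrightarrow> (\<forall>i\<ge>1. part nu i + part rho (Suc i) = hi i + lo (Suc i))" for rho nu
  have R_size: "sum_list nu + sum_list rho + lo 1 = sum_list lam + sum_list kap + part rho 1"
    if "is_partition nu" "is_partition rho" "R rho nu"
      "\<And>i. 1 \<le> i \<Longrightarrow> part rho (Suc i) \<le> hi i" "\<And>i. 1 \<le> i \<Longrightarrow> part nu i \<le> hi i" for rho nu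
  proof -
    have "(\<Sum>i=1..M. part nu i) + (\<Sum>i=1..M. part rho (Suc i)) = (\<Sum>i=1..M. hi i + lo (Suc i))"
      unfolding sum.distrib[symmetric] using that(3) by (intro sum.cong) (auto simp: R_def)
    then show ?thesis using that sums by (simp add: size_rho size_nu)
  qed
  have ex_nu: "\<exists>nu. nu \<in> ?Y \<and> R rho nu" if "rho \<in> ?X" for rho
  proof -
    have rho: "is_partition rho" "lo 1 \<le> part rho 1" "sum_list rho = sum_list kap + k"
      "\<And>i. 1 \<le> i \<Longrightarrow> lo (Suc i) \<le> part rho (Suc i) \<and> part rho (Suc i) \<le> hi i"
      using that unfolding X_iff by auto
    define g where "g i = hi i + lo (Suc i) - part rho (Suc i)" for i
    have g: "g i + part rho (Suc i) = hi i + lo (Suc i)" "lo (Suc i) \<le> g i" "g i \<le> hi i"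
      if "1 \<le> i" for i
      using rho(4)[OF that] by (auto simp: g_def)
    obtain nu where nu: "is_partition nu" "\<And>i. 1 \<le> i \<Longrightarrow> part nu i = g i"
    proof (rule partition_from_parts)
      show "g (Suc i) \<le> g i" if "1 \<le> i" for i
      proof -
        have "g (Suc i) \<le> hi (Suc i)" using g(3)[of "Suc i"] by simp
        also have "\<dots> \<le> lo (Suc i)" by (simp add: hi_def lo_def)
        finally show ?thesis using g(2)[OF that] by simp
      qed
      show "g (Suc M) = 0" using g(3)[of "Suc M"] hi_M[of "Suc M"] by simp
    qed (rule that, assumption, blast)
    have "R rho nu" using nu g by (simp add: R_def)
    moreover from R_size[OF nu(1) rho(1) this] have "sum_list lam \<le> sum_list nu + k"
      using rho nu g by auto
    ultimately show ?thesis using nu g Y_iff by auto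
  qed
  have ex_rho: "\<exists>rho. rho \<in> ?X \<and> R rho nu" if "nu \<in> ?Y" for nu
  proof -
    have nu: "is_partition nu" "sum_list lam \<le> sum_list nu + k"
      "\<And>i. 1 \<le> i \<Longrightarrow> lo (Suc i) \<le> part nu i \<and> part nu i \<le> hi i"
      using that unfolding Y_iff by auto
    \<comment> \<open>the first part is the one value that gives \<open>rho\<close> the prescribed size\<close>
    define g where "g i = (if i = 1 then lo 1 + (sum_list nu + k - sum_list lam)
      else hi (i - 1) + lo i - part nu (i - 1))" for i
    have g: "part nu i + g (Suc i) = hi i + lo (Suc i)" "lo (Suc i) \<le> g (Suc i)" "g (Suc i) \<le> hi i"
      if "1 \<le> i" for i
      using nu(3)[OF that] that by (auto simp: g_def)
    have g1: "lo 1 \<le> g 1" by (simp add: g_def)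
    have glo: "lo i \<le> g i" if "1 \<le> i" for i
      using g1 g(2)[of "i - 1"] that by (cases "i = 1") auto
    obtain rho where rho: "is_partition rho" "\<And>i. 1 \<le> i \<Longrightarrow> part rho i = g i"
    proof (rule partition_from_parts)
      show "g (Suc i) \<le> g i" if "1 \<le> i" for i
      proof -
        have "g (Suc i) \<le> hi i" using g(3)[OF that] by simp
        also have "\<dots> \<le> lo i" by (simp add: hi_def lo_def)
        finally show ?thesis using glo[OF that] by simp
      qed
      show "g (Suc M) = 0" using g(3)[of M] hi_M[of M] by (simp add: M_def)
    qed (rule that, assumption, blast)
    have "R rho nu" using rho g by (simp add: R_def)
    moreover from R_size[OF nu(1) rho(1) this] have "sum_list rho = sum_list kap + k"
      using rho nu g by (simp add: g_def)
    ultimately show ?thesis using rho g g1 X_iff by auto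
  qed
  have R_fun: "nu = nu'" if "R rho nu" "R rho nu'" "nu \<in> ?Y" "nu' \<in> ?Y" for rho nu nu'
  proof (rule partition_eqI)
    fix i :: nat assume "1 \<le> i"
    then show "part nu i = part nu' i" using that(1,2) unfolding R_def by (metis add_right_cancel)
  qed (use that in auto)
  have R_inj: "rho = rho'" if "R rho nu" "R rho' nu" "rho \<in> ?X" "rho' \<in> ?X" "nu \<in> ?Y" for rho rho' nu
  proof (rule partition_eqI)
    have tail: "part rho (Suc i) = part rho' (Suc i)" if "1 \<le> i" for i
      using \<open>R rho nu\<close> \<open>R rho' nu\<close> that unfolding R_def by (metis add_left_cancel)
    have "part rho 1 = part rho' 1"
      using R_size[of nu rho] R_size[of nu rho'] that(1,2) that(3,4,5)[unfolded X_iff Y_iff] by auto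
    then show "part rho i = part rho' i" if "1 \<le> i" for i
      using tail[of "i - 1"] that by (cases "i = 1") auto
  qed (use that in auto)
  have "bij_betw (\<lambda>rho. SOME nu. nu \<in> ?Y \<and> R rho nu) ?X ?Y"
  proof (rule bij_betwI[where g = "\<lambda>nu. SOME rho. rho \<in> ?X \<and> R rho nu"])
    have s1: "(SOME nu. nu \<in> ?Y \<and> R rho nu) \<in> ?Y \<and> R rho (SOME nu. nu \<in> ?Y \<and> R rho nu)"
      if "rho \<in> ?X" for rho using someI_ex[OF ex_nu[OF that]] .
    have s2: "(SOME rho. rho \<in> ?X \<and> R rho nu) \<in> ?X \<and> R (SOME rho. rho \<in> ?X \<and> R rho nu) nu"
      if "nu \<in> ?Y" for nu using someI_ex[OF ex_rho[OF that]] .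
    show "(\<lambda>rho. SOME nu. nu \<in> ?Y \<and> R rho nu) \<in> ?X \<rightarrow> ?Y" using s1 by blast
    show "(\<lambda>nu. SOME rho. rho \<in> ?X \<and> R rho nu) \<in> ?Y \<rightarrow> ?X" using s2 by blast
    show "(SOME rho'. rho' \<in> ?X \<and> R rho' (SOME nu. nu \<in> ?Y \<and> R rho nu)) = rho" if "rho \<in> ?X" for rho
      using s1[OF that] s2 R_inj that by blast
    show "(SOME nu'. nu' \<in> ?Y \<and> R (SOME rho. rho \<in> ?X \<and> R rho nu) nu') = nu" if "nu \<in> ?Y" for nu
      using s2[OF that] s1 R_fun that by blast
  qed
  then show ?thesis by (rule bij_betw_same_card)
qed

section \<open>The branching rule for semistandard tableaux\<close>

definition degree_of :: "(nat \<Rightarrow>\<^sub>0 nat) \<Rightarrow> nat" where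
  "degree_of \<alpha> = (\<Sum>i\<in>Poly_Mapping.keys \<alpha>. Poly_Mapping.lookup \<alpha> i)"

lemma degree_of_superset:
  assumes "finite A" "Poly_Mapping.keys \<alpha> \<subseteq> A"
  shows "degree_of \<alpha> = (\<Sum>i\<in>A. Poly_Mapping.lookup \<alpha> i)"
  unfolding degree_of_def using assms by (intro sum.mono_neutral_left) (auto simp: in_keys_iff)

lemma degree_of_0 [simp]: "degree_of 0 = 0"
  by (simp add: degree_of_def)

lemma degree_of_add: "degree_of (\<alpha> + \<beta>) = degree_of \<alpha> + degree_of \<beta>"
proof -
  let ?A = "Poly_Mapping.keys \<alpha> \<union> Poly_Mapping.keys \<beta>"
  have "Poly_Mapping.keys (\<alpha> + \<beta>) \<subseteq> ?A" by (rule keys_add)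
  then show ?thesis
    by (simp add: degree_of_superset[of ?A] lookup_add sum.distrib)
qed

lemma degree_of_single [simp]: "degree_of (Poly_Mapping.single i k) = k"
  by (simp add: degree_of_superset[of "{i}"])

lemma degree_of_content: "degree_of (content lam mu T) = card (skew_diagram lam mu)"
proof -
  have "degree_of (\<Sum>c\<in>D. Poly_Mapping.single (T c) 1) = card D" if "finite D" for D
    using that by (induction rule: finite_induct) (simp_all add: degree_of_add)
  then show ?thesis by (simp add: content_def)
qed

lemma lookup_content:
  "Poly_Mapping.lookup (content lam mu T) m = card {c \<in> skew_diagram lam mu. T c = m}"
proof -
  have "Poly_Mapping.lookup (content lam mu T) m
      = (\<Sum>c\<in>skew_diagram lam mu. if T c = m then Suc 0 else 0)"
    by (simp add: content_def lookup_sum lookup_single when_def cong: if_cong)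
  also have "\<dots> = card {c \<in> skew_diagram lam mu. T c = m}"
    by (simp add: sum.If_cases Int_def conj_commute)
  finally show ?thesis .
qed

lemma content_eq_iff:
  "content lam mu T = \<alpha> \<longleftrightarrow>
     (\<forall>m. card {c \<in> skew_diagram lam mu. T c = m} = Poly_Mapping.lookup \<alpha> m)"
  by (auto simp: lookup_content[symmetric] intro: poly_mapping_eqI)

definition tableaux :: "nat list \<Rightarrow> nat list \<Rightarrow> (nat \<Rightarrow>\<^sub>0 nat) \<Rightarrow> (nat \<times> nat \<Rightarrow> nat) set" where
  "tableaux lam mu \<alpha> = {T \<in> ssyt lam mu. content lam mu T = \<alpha>}"

lemma finite_tableaux [simp]: "finite (tableaux lam mu \<alpha>)"
  by (simp add: tableaux_def)

lemma tableau_entry_in_keys: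
  assumes "T \<in> tableaux lam mu \<alpha>" "c \<in> skew_diagram lam mu"
  shows "T c \<in> Poly_Mapping.keys \<alpha>"
proof -
  have "{d \<in> skew_diagram lam mu. T d = T c} \<noteq> {}" using assms(2) by blast
  then have "card {d \<in> skew_diagram lam mu. T d = T c} \<noteq> 0" by simp
  then show ?thesis
    using assms(1) unfolding tableaux_def in_keys_iff lookup_content[symmetric] by blast
qed

lemma tableau_outside:
  "T \<in> tableaux lam mu \<alpha> \<Longrightarrow> c \<notin> skew_diagram lam mu \<Longrightarrow> T c = undefined"
  unfolding tableaux_def ssyt_def by (auto intro: PiE_arb)

lemma tableaux_rows:
  "T \<in> tableaux lam mu \<alpha> \<Longrightarrow> (i, j) \<in> skew_diagram lam mu \<Longrightarrow> (i, j') \<in> skew_diagram lam mu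
     \<Longrightarrow> j \<le> j' \<Longrightarrow> T (i, j) \<le> T (i, j')"
  unfolding tableaux_def ssyt_def by (cases "j = j'") auto

lemma tableaux_columns:
  "T \<in> tableaux lam mu \<alpha> \<Longrightarrow> (i, j) \<in> skew_diagram lam mu \<Longrightarrow> (i', j) \<in> skew_diagram lam mu
     \<Longrightarrow> i < i' \<Longrightarrow> T (i, j) < T (i', j)"
  unfolding tableaux_def ssyt_def by auto

lemma skew_diagram_split:
  assumes "contained mu nu" "contained nu lam"
  shows "skew_diagram lam mu = skew_diagram nu mu \<union> skew_diagram lam nu"
    and "skew_diagram nu mu \<inter> skew_diagram lam nu = {}"
proof -
  have *: "(i, j) \<in> skew_diagram lam mu
      \<longleftrightarrow> (i, j) \<in> skew_diagram nu mu \<or> (i, j) \<in> skew_diagram lam nu"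
    "\<not> ((i, j) \<in> skew_diagram nu mu \<and> (i, j) \<in> skew_diagram lam nu)" for i j
  proof -
    have "part mu i \<le> part nu i" "part nu i \<le> part lam i" if "1 \<le> i"
      using assms that by (simp_all add: contained_def)
    then show "(i, j) \<in> skew_diagram lam mu
      \<longleftrightarrow> (i, j) \<in> skew_diagram nu mu \<or> (i, j) \<in> skew_diagram lam nu"
      "\<not> ((i, j) \<in> skew_diagram nu mu \<and> (i, j) \<in> skew_diagram lam nu)"
      unfolding mem_skew_diagram by linarith+
  qed
  show "skew_diagram lam mu = skew_diagram nu mu \<union> skew_diagram lam nu"
    "skew_diagram nu mu \<inter> skew_diagram lam nu = {}"
    using * by auto
qed

lemma initial_segment:
  assumes "X \<subseteq> {m<..M}" "\<And>j j'. j' \<in> X \<Longrightarrow> m < j \<Longrightarrow> j \<le> j' \<Longrightarrow> j \<in> X"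
  shows "X = {m<..m + card X}"
proof (cases "X = {}")
  case False
  have fin: "finite X" using assms(1) by (rule finite_subset) simp
  have "X = {m<..Max X}"
  proof (intro equalityI subsetI)
    fix j assume "j \<in> X"
    then show "j \<in> {m<..Max X}" using assms(1) Max_ge[OF fin] by auto
  next
    fix j assume "j \<in> {m<..Max X}"
    then show "j \<in> X" using assms(2)[OF Max_in[OF fin False]] by simp
  qed
  moreover from this have "card X = Max X - m" by (metis card_greaterThanAtMost)
  moreover have "m < Max X" using Max_in[OF fin False] assms(1) by auto
  ultimately show ?thesis by simp
qed simp

text \<open>
  The entries of a tableau that are smaller than its largest possible entry \<open>n\<close> fill a smaller skew
  shape, since rows and columns increase; the cells with entry \<open>n\<close> form a horizontal strip because
  columns increase strictly.
\<close>

lemma tableau_inner_shape: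
  assumes lam: "is_partition lam" and mu: "is_partition mu" and sub: "contained mu lam"
    and keys: "Poly_Mapping.keys \<beta> \<subseteq> {..<n}"
    and T: "T \<in> tableaux lam mu (\<beta> + Poly_Mapping.single n k)"
  obtains nu where "is_partition nu" "horizontal_strip lam nu" "contained mu nu"
    "sum_list lam = sum_list nu + k"
    "{c \<in> skew_diagram lam mu. T c < n} = skew_diagram nu mu"
proof -
  let ?D = "skew_diagram lam mu"
  let ?X = "\<lambda>i. {j. (i, j) \<in> ?D \<and> T (i, j) < n}"
  have le_n: "T c \<le> n" if "c \<in> ?D" for c
    using tableau_entry_in_keys[OF T that] keys keys_add[of \<beta> "Poly_Mapping.single n k"]
    by (auto split: if_splits)
  define g where "g i = part mu i + card (?X i)" for i
  have X: "?X i = {part mu i<..g i}" if "1 \<le> i" for i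
    unfolding g_def
  proof (rule initial_segment)
    show "?X i \<subseteq> {part mu i<..part lam i}" by (auto simp: mem_skew_diagram)
    fix j j' assume "j' \<in> ?X i" "part mu i < j" "j \<le> j'"
    moreover from this have "(i, j) \<in> ?D" by (auto simp: mem_skew_diagram)
    ultimately show "j \<in> ?X i" using tableaux_rows[OF T, of i j j'] by auto
  qed
  have mem_X: "(i, j) \<in> ?D \<and> T (i, j) < n \<longleftrightarrow> part mu i < j \<and> j \<le> g i" if "1 \<le> i" for i j
  proof -
    have "j \<in> ?X i \<longleftrightarrow> j \<in> {part mu i<..g i}" by (simp only: X[OF that])
    then show ?thesis by simp
  qed
  have g_ge: "part mu i \<le> g i" for i by (simp add: g_def)
  have g_le: "g i \<le> part lam i" if "1 \<le> i" for i
  proof (cases "part mu i < g i")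
    case True
    then have "(i, g i) \<in> ?D" using mem_X[OF that, of "g i"] by blast
    then show ?thesis by (simp add: mem_skew_diagram)
  next
    case False
    then have "g i = part mu i" using g_ge[of i] by simp
    then show ?thesis using sub that by (simp add: contained_def)
  qed
  have strip: "part lam (Suc i) \<le> g i" if "1 \<le> i" for i
  proof (rule ccontr)
    let ?j = "part lam (Suc i)"
    assume "\<not> ?j \<le> g i"
    then have j: "g i < ?j" by simp
    have c: "(i, ?j) \<in> ?D" "(Suc i, ?j) \<in> ?D"
      using j g_ge[of i] part_Suc_le[OF lam that] part_Suc_le[OF mu that] that
      by (auto simp: mem_skew_diagram)
    then have "n \<le> T (i, ?j)" using mem_X[OF that, of ?j] j by linarith
    also have "\<dots> < T (Suc i, ?j)" using tableaux_columns[OF T c] by simp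
    finally show False using le_n[OF c(2)] by simp
  qed
  have decreasing: "g (Suc i) \<le> g i" if "1 \<le> i" for i
    using g_le[of "Suc i"] strip[OF that] that by simp
  obtain nu where nu: "is_partition nu" "\<And>i. 1 \<le> i \<Longrightarrow> part nu i = g i"
  proof (rule partition_from_parts)
    show "g (Suc i) \<le> g i" if "1 \<le> i" for i by (rule decreasing[OF that])
    show "g (Suc (length lam)) = 0"
      using g_le[of "Suc (length lam)"] by (simp add: part_beyond_length)
  qed (rule that, assumption, blast)
  have mu_nu: "contained mu nu" and nu_lam: "contained nu lam"
    using nu g_ge g_le by (auto simp: contained_def)
  have inner: "{c \<in> ?D. T c < n} = skew_diagram nu mu"
  proof (rule set_eqI)
    fix c :: "nat \<times> nat"
    obtain i j where c: "c = (i, j)" by (cases c)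
    show "c \<in> {c \<in> ?D. T c < n} \<longleftrightarrow> c \<in> skew_diagram nu mu"
    proof (cases "1 \<le> i")
      case True
      then show ?thesis using mem_X[OF True, of j] nu c by (auto simp: mem_skew_diagram)
    qed (auto simp: c mem_skew_diagram)
  qed
  have "{c \<in> ?D. T c = n} = skew_diagram lam nu"
  proof -
    have "{c \<in> ?D. T c = n} = ?D - {c \<in> ?D. T c < n}" using le_n by force
    then show ?thesis using inner skew_diagram_split[OF mu_nu nu_lam] by auto
  qed
  moreover have "card {c \<in> ?D. T c = n} = k"
  proof -
    have "Poly_Mapping.lookup \<beta> n = 0"
      using keys by (meson in_keys_iff lessThan_iff less_irrefl subsetD)
    then show ?thesis
      using T by (auto simp: tableaux_def content_eq_iff lookup_add)
  qed
  ultimately have "sum_list lam = sum_list nu + k"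
    using card_skew_diagram[OF nu_lam] contained_sum_le[OF nu_lam] by simp
  moreover have "horizontal_strip lam nu"
    using nu nu_lam strip by (simp add: horizontal_strip_def)
  ultimately show thesis using that nu(1) mu_nu inner by blast
qed

text \<open>
  A tableau of the inner shape extends in exactly one way: all remaining cells receive the entry \<open>n\<close>.
\<close>

lemma card_tableaux_inner:
  assumes lam: "is_partition lam" and nu: "is_partition nu"
    and strip: "horizontal_strip lam nu" and mu_nu: "contained mu nu"
    and size: "sum_list lam = sum_list nu + k"
    and keys: "Poly_Mapping.keys \<beta> \<subseteq> {..<n}"
  shows "card {T \<in> tableaux lam mu (\<beta> + Poly_Mapping.single n k).
      {c \<in> skew_diagram lam mu. T c < n} = skew_diagram nu mu} = card (tableaux nu mu \<beta>)"
    (is "card ?K = card ?L")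
proof -
  let ?D = "skew_diagram lam mu" and ?I = "skew_diagram nu mu" and ?O = "skew_diagram lam nu"
  have nu_lam: "contained nu lam" using strip by (simp add: horizontal_strip_def)
  note split = skew_diagram_split[OF mu_nu nu_lam]
  have I_sub: "?I \<subseteq> ?D" using split(1) by blast
  have card_O: "card ?O = k" using card_skew_diagram[OF nu_lam] size by simp
  have \<beta>0: "Poly_Mapping.lookup \<beta> m = 0" if "n \<le> m" for m
    using keys that by (meson in_keys_iff lessThan_iff not_less subsetD)
  let ?glue = "\<lambda>T c. if c \<in> ?I then T c else if c \<in> ?D then n else undefined"
  have "bij_betw (\<lambda>T. restrict T ?I) ?K ?L"
  proof (rule bij_betwI[where g = ?glue])
    show "(\<lambda>T. restrict T ?I) \<in> ?K \<rightarrow> ?L"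
    proof
      fix T assume "T \<in> ?K"
      then have T: "T \<in> tableaux lam mu (\<beta> + Poly_Mapping.single n k)"
        and inner: "{c \<in> ?D. T c < n} = ?I" by auto
      have "restrict T ?I \<in> ssyt nu mu"
        unfolding ssyt_def
      proof (intro CollectI conjI allI impI)
        fix i j j' assume "(i, j) \<in> ?I \<and> (i, j') \<in> ?I \<and> j < j'"
        then show "restrict T ?I (i, j) \<le> restrict T ?I (i, j')"
          using tableaux_rows[OF T, of i j j'] I_sub by auto
      next
        fix i i' j assume "(i, j) \<in> ?I \<and> (i', j) \<in> ?I \<and> i < i'"
        then show "restrict T ?I (i, j) < restrict T ?I (i', j)"
          using tableaux_columns[OF T, of i j i'] I_sub by auto
      qed simp
      moreover have "card {c \<in> ?I. restrict T ?I c = m} = Poly_Mapping.lookup \<beta> m" for m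
      proof (cases "m < n")
        case True
        then have "{c \<in> ?I. restrict T ?I c = m} = {c \<in> ?D. T c = m}"
          using inner by auto
        then show ?thesis
          using T True by (simp add: tableaux_def content_eq_iff lookup_add lookup_single when_def)
      next
        case False
        then have "{c \<in> ?I. restrict T ?I c = m} = {}" using inner by auto
        then show ?thesis using \<beta>0[of m] False by (simp only: card.empty not_less)
      qed
      ultimately show "restrict T ?I \<in> ?L" by (simp add: tableaux_def content_eq_iff)
    qed
    show "?glue \<in> ?L \<rightarrow> ?K"
    proof
      fix T assume T: "T \<in> ?L"
      have less: "T c < n" if "c \<in> ?I" for c
        using tableau_entry_in_keys[OF T that] keys by auto
      have "?glue T \<in> ssyt lam mu"
        unfolding ssyt_def
      proof (intro CollectI conjI allI impI)
        show "?glue T \<in> ?D \<rightarrow>\<^sub>E UNIV" using I_sub by (auto simp: PiE_iff extensional_def)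
        fix i j j' assume "(i, j) \<in> ?D \<and> (i, j') \<in> ?D \<and> j < j'"
        then show "?glue T (i, j) \<le> ?glue T (i, j')"
          using tableaux_rows[OF T, of i j j'] less[of "(i, j)"]
          by (auto simp: mem_skew_diagram)
      next
        fix i i' j assume ij: "(i, j) \<in> ?D \<and> (i', j) \<in> ?D \<and> i < i'"
        have "(i, j) \<in> ?I"
        proof -
          have "part lam i' \<le> part lam (Suc i)" using ij part_antimono[OF lam, of "Suc i" i'] by simp
          also have "\<dots> \<le> part nu i"
            using strip ij by (simp add: horizontal_strip_def mem_skew_diagram)
          finally show ?thesis using ij by (auto simp: mem_skew_diagram)
        qed
        then show "?glue T (i, j) < ?glue T (i', j)"
          using tableaux_columns[OF T, of i j i'] less[of "(i, j)"] ij by auto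
      qed
      moreover have "card {c \<in> ?D. ?glue T c = m}
          = Poly_Mapping.lookup (\<beta> + Poly_Mapping.single n k) m" for m
      proof (cases "m = n")
        case True
        have "{c \<in> ?D. ?glue T c = m} = ?O" using True split less by fastforce
        then show ?thesis using True card_O \<beta>0[of n] by (simp add: lookup_add)
      next
        case False
        have "{c \<in> ?D. ?glue T c = m} = {c \<in> ?I. T c = m}" using False I_sub by auto
        then show ?thesis
          using T False by (simp add: tableaux_def content_eq_iff lookup_add lookup_single when_def)
      qed
      moreover have "{c \<in> ?D. ?glue T c < n} = ?I" using less I_sub by auto
      ultimately show "?glue T \<in> ?K" by (simp add: tableaux_def content_eq_iff)
    qed
    show "?glue (restrict T ?I) = T" if "T \<in> ?K" for T
    proof
      fix c
      have T: "T \<in> tableaux lam mu (\<beta> + Poly_Mapping.single n k)"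
        and inner: "{c \<in> ?D. T c < n} = ?I" using that by auto
      show "?glue (restrict T ?I) c = T c"
      proof (cases "c \<in> ?D")
        case True
        have "T c \<in> Poly_Mapping.keys (\<beta> + Poly_Mapping.single n k)"
          by (rule tableau_entry_in_keys[OF T True])
        then have "T c \<le> n"
          using keys keys_add[of \<beta> "Poly_Mapping.single n k"] by (auto split: if_splits)
        moreover have "c \<in> ?I \<longleftrightarrow> T c < n" using inner True by blast
        ultimately show ?thesis using True by simp
      next
        case False
        then have "c \<notin> ?I" using I_sub by blast
        then show ?thesis using tableau_outside[OF T False] False by simp
      qed
    qed
    show "restrict (?glue T) ?I = T" if "T \<in> ?L" for T
    proof
      show "restrict (?glue T) ?I c = T c" for c
        using tableau_outside[OF that, of c] by (cases "c \<in> ?I") simp_all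
    qed
  qed
  then show ?thesis by (rule bij_betw_same_card)
qed

lemma skew_diagram_inner_inj:
  assumes "is_partition nu" "is_partition nu'" "contained mu nu" "contained mu nu'"
    and "skew_diagram nu mu = skew_diagram nu' mu"
  shows "nu = nu'"
proof (rule partition_eqI[OF assms(1,2)])
  fix i :: nat assume i: "1 \<le> i"
  have "part mu i < j \<and> j \<le> part nu i \<longleftrightarrow> part mu i < j \<and> j \<le> part nu' i" for j
    using assms(5) i mem_skew_diagram[of i j] by blast
  from this[of "part nu i"] this[of "part nu' i"] show "part nu i = part nu' i"
    using assms(3,4) i unfolding contained_def by (metis le_antisym le_neq_implies_less order_refl)
qed

text \<open>
  This is the branching rule: splitting off the last variable of a skew Schur function.
\<close>

lemma card_tableaux_recursion:
  assumes lam: "is_partition lam" and mu: "is_partition mu" and sub: "contained mu lam"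
    and keys: "Poly_Mapping.keys \<beta> \<subseteq> {..<n}"
  shows "card (tableaux lam mu (\<beta> + Poly_Mapping.single n k))
    = (\<Sum>nu | is_partition nu \<and> horizontal_strip lam nu \<and> contained mu nu \<and>
          sum_list lam = sum_list nu + k. card (tableaux nu mu \<beta>))"
    (is "card ?K = sum _ ?V")
proof -
  let ?K' = "\<lambda>nu. {T \<in> ?K. {c \<in> skew_diagram lam mu. T c < n} = skew_diagram nu mu}"
  have "?V \<subseteq> partitions_upto (sum_list lam)" by (auto simp: partitions_upto_def)
  then have fin: "finite ?V" by (rule finite_subset) simp
  have "?K = (\<Union>nu\<in>?V. ?K' nu)"
  proof (intro equalityI subsetI)
    fix T assume "T \<in> ?K"
    then show "T \<in> (\<Union>nu\<in>?V. ?K' nu)"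
      using tableau_inner_shape[OF lam mu sub keys, of T k] by blast
  qed auto
  then have "card ?K = card (\<Union>nu\<in>?V. ?K' nu)" by (rule arg_cong)
  also have "\<dots> = (\<Sum>nu\<in>?V. card (?K' nu))"
  proof (rule card_UN_disjoint[OF fin])
    show "\<forall>nu\<in>?V. \<forall>nu'\<in>?V. nu \<noteq> nu' \<longrightarrow> ?K' nu \<inter> ?K' nu' = {}"
    proof (intro ballI impI)
      fix nu nu' assume "nu \<in> ?V" "nu' \<in> ?V" "nu \<noteq> nu'"
      then have "skew_diagram nu mu \<noteq> skew_diagram nu' mu"
        using skew_diagram_inner_inj by blast
      then show "?K' nu \<inter> ?K' nu' = {}" by auto
    qed
  qed auto
  also have "\<dots> = (\<Sum>nu\<in>?V. card (tableaux nu mu \<beta>))"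
    by (intro sum.cong card_tableaux_inner refl) (use lam keys in auto)
  finally show ?thesis .
qed

lemma mcoeff_skew_schur: "mcoeff (skew_schur lam mu) \<alpha> = of_nat (card (tableaux lam mu \<alpha>))"
  by (simp add: skew_schur_def tableaux_def Abs_mfps_inverse)

lemma tableaux_degree:
  assumes "tableaux lam mu \<alpha> \<noteq> {}" "contained mu lam"
  shows "sum_list lam = sum_list mu + degree_of \<alpha>"
proof -
  obtain T where "content lam mu T = \<alpha>" using assms(1) unfolding tableaux_def by blast
  then have "degree_of \<alpha> = card (skew_diagram lam mu)"
    using degree_of_content[of lam mu T] by simp
  then show ?thesis using card_skew_diagram[OF assms(2)] contained_sum_le[OF assms(2)] by simp
qed

lemma tableaux_same: "tableaux lam lam 0 = {\<lambda>_. undefined}"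
proof -
  have "skew_diagram lam lam = {}" by (auto simp: mem_skew_diagram)
  then show ?thesis by (auto simp: tableaux_def ssyt_def content_def)
qed

section \<open>Coefficients of the quantum power sums\<close>

lemma mcoeff_sum: "mcoeff (\<Sum>i\<in>A. f i) \<alpha> = (\<Sum>i\<in>A. mcoeff (f i) \<alpha>)"
  by (induction A rule: infinite_finite_induct) (simp_all add: zero_mfps.rep_eq plus_mfps.rep_eq)

lemma q_neq_1: "q - 1 \<noteq> 0"
proof -
  have "Fract [:0, 1 :: rat:] 1 \<noteq> Fract 1 1" by (simp add: eq_fract one_pCons)
  then have "q \<noteq> 1" by (simp only: q_def One_fract_def not_False_eq_True)
  then show ?thesis by simp
qed

lemma partition_of_mset:
  assumes "is_partition tau"
  shows "tau = rev (sorted_list_of_multiset (mset tau))"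
proof -
  have "sorted (rev tau)" using assms by (simp add: is_partition_def sorted_wrt_rev)
  then have "sort tau = rev tau" by (intro properties_for_sort) simp_all
  then show ?thesis by simp
qed

text \<open>
  Exactly one partition of \<open>r\<close>, the sorted exponent vector, contributes to a monomial of degree \<open>r\<close>.
  The formula says that \<open>(1 - q)\<close> times the quantum power sum is the degree-\<open>r\<close> part of the product of
  \<open>(1 - q x) / (1 - x)\<close> over all variables \<open>x\<close>.
\<close>

lemma mcoeff_quantum_power_sum:
  "mcoeff (quantum_power_sum r) \<alpha>
    = (if degree_of \<alpha> = r then - inverse (q - 1) * (1 - q) ^ card (Poly_Mapping.keys \<alpha>) else 0)"
proof -
  let ?M = "image_mset (Poly_Mapping.lookup \<alpha>) (mset_set (Poly_Mapping.keys \<alpha>))"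
  let ?t = "rev (sorted_list_of_multiset ?M)"
  let ?c = "\<lambda>l. (-1) powi (int l - 1) * (q - 1) powi (int l - 1)"
  have set: "set_mset ?M = Poly_Mapping.lookup \<alpha> ` Poly_Mapping.keys \<alpha>" by simp
  have "sum_mset ?M = degree_of \<alpha>" by (simp add: degree_of_def sum_unfold_sum_mset)
  then have "sum_list ?t = degree_of \<alpha>"
    by (metis mset_rev mset_sorted_list_of_multiset sum_mset_sum_list)
  moreover have "0 \<notin># ?M" unfolding set by (auto simp: in_keys_iff)
  ultimately have t: "?t \<in> partitions_of r \<longleftrightarrow> degree_of \<alpha> = r"
    by (auto simp: partitions_of_def is_partition_def sorted_wrt_rev)
  have uniq: "?M = mset tau \<longleftrightarrow> tau = ?t" if "tau \<in> partitions_of r" for tau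
    using partition_of_mset[of tau] that
    by (metis (no_types, lifting) mem_Collect_eq mset_rev mset_sorted_list_of_multiset partitions_of_def)
  have len: "length ?t = card (Poly_Mapping.keys \<alpha>)"
    by (metis length_rev mset_sorted_list_of_multiset size_image_mset size_mset size_mset_set)
  have "mcoeff (quantum_power_sum r) \<alpha>
      = (\<Sum>tau\<in>partitions_of r. ?c (length tau) * (if ?M = mset tau then 1 else 0))"
    by (simp add: quantum_power_sum_def mcoeff_sum mscale.rep_eq monomial_sym_def Abs_mfps_inverse)
  also have "\<dots> = (\<Sum>tau\<in>partitions_of r. if tau = ?t then ?c (length tau) else 0)"
    by (intro sum.cong) (auto simp: uniq)
  also have "\<dots> = (if degree_of \<alpha> = r then ?c (card (Poly_Mapping.keys \<alpha>)) else 0)"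
    using t len by (simp add: sum.delta)
  also have "?c (card (Poly_Mapping.keys \<alpha>))
      = - inverse (q - 1) * (1 - q) ^ card (Poly_Mapping.keys \<alpha>)"
  proof -
    have "?c l = (1 - q) powi (int l - 1)" for l
      by (simp add: power_int_mult_distrib[symmetric])
    also have "(1 - q) powi (int l - 1) = - inverse (q - 1) * (1 - q) ^ l" for l
      using q_neq_1 by (simp add: power_int_diff field_simps)
    finally show ?thesis .
  qed
  finally show ?thesis .
qed

section \<open>Matrices indexed by partitions\<close>

type_synonym 'a pmatrix = "nat list \<Rightarrow> nat list \<Rightarrow> 'a"

definition mprod :: "nat \<Rightarrow> 'a::comm_ring_1 pmatrix \<Rightarrow> 'a pmatrix \<Rightarrow> 'a pmatrix" where
  "mprod N X Y = (\<lambda>x y. \<Sum>z\<in>partitions_upto N. X x z * Y z y)"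

definition ident :: "'a::comm_ring_1 pmatrix" where
  "ident x y = (if x = y then 1 else 0)"

lemma mprod_assoc: "mprod N (mprod N X Y) Z = mprod N X (mprod N Y Z)"
proof (intro ext)
  fix x y
  have "mprod N (mprod N X Y) Z x y
      = (\<Sum>z\<in>partitions_upto N. \<Sum>w\<in>partitions_upto N. X x w * Y w z * Z z y)"
    by (simp add: mprod_def sum_distrib_right)
  also have "\<dots> = (\<Sum>w\<in>partitions_upto N. \<Sum>z\<in>partitions_upto N. X x w * Y w z * Z z y)"
    by (rule sum.swap)
  also have "\<dots> = mprod N X (mprod N Y Z) x y"
    by (simp add: mprod_def sum_distrib_left mult.assoc)
  finally show "mprod N (mprod N X Y) Z x y = mprod N X (mprod N Y Z) x y" .
qed

lemma mprod_ident_right: "y \<in> partitions_upto N \<Longrightarrow> mprod N X ident x y = X x y"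
  by (simp add: mprod_def ident_def if_distrib[of "(*) _"] cong: if_cong)

lemma mprod_ident_left: "x \<in> partitions_upto N \<Longrightarrow> mprod N ident X x y = X x y"
  by (simp add: mprod_def ident_def if_distrib[of "\<lambda>t. t * _"] cong: if_cong)

lemma mprod_cong:
  assumes "\<And>z. z \<in> partitions_upto N \<Longrightarrow> X x z * Y z y = X' x z * Y' z y"
  shows "mprod N X Y x y = mprod N X' Y' x y"
  unfolding mprod_def using assms by (intro sum.cong) auto

lemma mprod_diff_right: "mprod N X (\<lambda>x y. Y x y - Z x y) x y = mprod N X Y x y - mprod N X Z x y"
  by (simp add: mprod_def algebra_simps sum_subtractf)

definition supported_on_containment :: "'a::comm_ring_1 pmatrix \<Rightarrow> bool" where
  "supported_on_containment X \<longleftrightarrow> (\<forall>x y. X x y \<noteq> 0 \<longrightarrow> contained x y)"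

text \<open>
  A unitriangular matrix is cancellable on the left: if \<open>A X = 0\<close>, then the entries of \<open>X\<close> vanish one
  row at a time, starting with the largest partitions.  Applied to \<open>X = B A - 1\<close> this turns a right
  inverse into a left inverse.
\<close>

lemma left_inverse_of_right_inverse:
  assumes A: "supported_on_containment A" "\<And>x. x \<in> partitions_upto N \<Longrightarrow> A x x = 1"
    and AB: "\<And>x y. x \<in> partitions_upto N \<Longrightarrow> y \<in> partitions_upto N \<Longrightarrow> mprod N A B x y = ident x y"
    and x: "x \<in> partitions_upto N" and y: "y \<in> partitions_upto N"
  shows "mprod N B A x y = ident x y"
proof -
  let ?Q = "partitions_upto N"
  define X where "X = (\<lambda>x y. mprod N B A x y - ident x y)"
  have AX: "mprod N A X x y = 0" if "x \<in> ?Q" for x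
  proof -
    have "mprod N A (mprod N B A) x y = mprod N ident A x y"
      unfolding mprod_assoc[symmetric] using AB that by (intro mprod_cong) simp
    then show ?thesis
      unfolding X_def by (simp add: mprod_diff_right mprod_ident_left mprod_ident_right that y)
  qed
  have "X x y = 0" using x
  proof (induction "N - sum_list x" arbitrary: x rule: less_induct)
    case less
    have "A x z * X z y = 0" if z: "z \<in> ?Q" "z \<noteq> x" for z
    proof (cases "A x z = 0")
      case False
      then have "contained x z" using A(1) by (auto simp: supported_on_containment_def)
      then have "sum_list x < sum_list z"
        using contained_sum_eq[of z x] contained_sum_le[of x z] z less.prems
        by (force simp: partitions_upto_def)
      then have "X z y = 0" using z by (intro less.hyps) (auto simp: partitions_upto_def)
      then show ?thesis by simp
    qed simp
    then have "mprod N A X x y = A x x * X x y"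
      unfolding mprod_def using less.prems by (subst sum.remove[of _ x]) auto
    then show ?case using AX[OF less.prems] A(2)[OF less.prems] by simp
  qed
  then show ?thesis by (simp add: X_def)
qed

text \<open>
  The row index is the smaller partition for the matrices that add strips and the larger one for the
  matrix that removes a strip, so that products are read as paths from left to right.
\<close>

definition add_hstrip :: "'a::comm_ring_1 \<Rightarrow> 'a pmatrix" where
  "add_hstrip a lam rho =
     (if horizontal_strip rho lam then a ^ (sum_list rho - sum_list lam) else 0)"

definition add_vstrip :: "'a::comm_ring_1 \<Rightarrow> 'a pmatrix" where
  "add_vstrip b lam rho =
     (if vertical_strip rho lam then b ^ (sum_list rho - sum_list lam) else 0)"

definition remove_hstrip :: "nat \<Rightarrow> 'a::comm_ring_1 pmatrix" where
  "remove_hstrip k lam nu =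
     (if horizontal_strip lam nu \<and> sum_list lam = sum_list nu + k then 1 else 0)"

lemma supported_on_containment_add_hstrip: "supported_on_containment (add_hstrip a)"
  by (simp add: supported_on_containment_def add_hstrip_def horizontal_strip_def)

lemma supported_on_containment_add_vstrip: "supported_on_containment (add_vstrip b)"
  by (simp add: supported_on_containment_def add_vstrip_def vertical_strip_def)

lemma supported_on_containment_le: "supported_on_containment X \<Longrightarrow> X x y \<noteq> 0 \<Longrightarrow> sum_list x \<le> sum_list y"
  by (auto simp: supported_on_containment_def intro: contained_sum_le)

lemma add_hstrip_vstrip:
  assumes "lam \<in> partitions_upto N" "rho \<in> partitions_upto N"
  shows "mprod N (add_hstrip a) (add_vstrip b) lam rho = ribbon_weight a b lam rho"
proof -
  have p: "is_partition rho" "is_partition lam" using assms by (auto simp: partitions_upto_def)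
  have "mprod N (add_hstrip a) (add_vstrip b) lam rho
      = (\<Sum>nu\<in>strip_between rho lam.
          a ^ (sum_list nu - sum_list lam) * b ^ (sum_list rho - sum_list nu))"
    unfolding mprod_def
  proof (rule sum.mono_neutral_cong_right)
    show "strip_between rho lam \<subseteq> partitions_upto N"
      using assms contained_sum_le le_trans
      by (fastforce simp: strip_between_def partitions_upto_def vertical_strip_def)
    show "finite (partitions_upto N)" by simp
  qed (auto simp: strip_between_def add_hstrip_def add_vstrip_def partitions_upto_def)
  then show ?thesis by (simp add: sum_strip_between[OF p])
qed

lemma add_hstrip_vstrip_inverse:
  assumes "x \<in> partitions_upto N" "y \<in> partitions_upto N"
  shows "mprod N (add_hstrip a) (add_vstrip (- a)) x y = ident x y"
  using assms by (simp add: add_hstrip_vstrip partitions_upto_def ribbon_weight_cancel ident_def)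

lemma add_vstrip_hstrip_inverse:
  assumes "x \<in> partitions_upto N" "y \<in> partitions_upto N"
  shows "mprod N (add_vstrip (- a)) (add_hstrip a) x y = ident x y"
proof (rule left_inverse_of_right_inverse[OF supported_on_containment_add_hstrip _ add_hstrip_vstrip_inverse])
  show "add_hstrip a x x = 1" if "x \<in> partitions_upto N" for x
    using that part_Suc_le by (simp add: add_hstrip_def horizontal_strip_def partitions_upto_def)
qed (use assms in auto)

section \<open>Commuting strips past the branching of tableaux\<close>

definition conv :: "'a::comm_ring_1 fps \<Rightarrow> (nat \<Rightarrow> 'a) \<Rightarrow> nat \<Rightarrow> 'a" where
  "conv f Z k = (\<Sum>i\<le>k. fps_nth f i * Z (k - i))"

lemma conv_conv: "conv f (conv g Z) k = conv (f * g) Z k"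
proof -
  have *: "conv f Z k = fps_nth (f * Abs_fps Z) k" for f Z k
    by (simp add: conv_def fps_mult_nth atLeast0AtMost)
  have "Abs_fps (conv g Z) = g * Abs_fps Z" by (rule fps_ext) (simp add: *)
  then show ?thesis by (simp add: * mult.assoc)
qed

lemma conv_1: "conv 1 Z k = Z k"
proof -
  have "conv 1 Z k = (\<Sum>i\<le>k. if i = 0 then Z k else 0)"
    unfolding conv_def by (intro sum.cong) auto
  then show ?thesis by simp
qed

lemma conv_cong: "(\<And>j. j \<le> k \<Longrightarrow> Z j = Z' j) \<Longrightarrow> conv f Z k = conv f Z' k"
  by (simp add: conv_def)

text \<open>
  With the generating matrix \<open>U(x)\<close> of all matrices \<open>remove_hstrip k\<close> times \<open>x ^ k\<close>, this is the relation
  \<open>X U(x) = f(x) U(x) X\<close>.  The restriction on the column \<open>y\<close> keeps all intermediate shapes on the left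
  side within the truncation bound.
\<close>

definition shifts :: "nat \<Rightarrow> 'a::comm_ring_1 fps \<Rightarrow> 'a pmatrix \<Rightarrow> bool" where
  "shifts N f X \<longleftrightarrow> (\<forall>x\<in>partitions_upto N. \<forall>y\<in>partitions_upto N. \<forall>k. sum_list y + k \<le> N \<longrightarrow>
     mprod N X (remove_hstrip k) x y = conv f (\<lambda>j. mprod N (remove_hstrip j) X x y) k)"

lemma shiftsD:
  "shifts N f X \<Longrightarrow> x \<in> partitions_upto N \<Longrightarrow> y \<in> partitions_upto N \<Longrightarrow> sum_list y + k \<le> N \<Longrightarrow>
     mprod N X (remove_hstrip k) x y = conv f (\<lambda>j. mprod N (remove_hstrip j) X x y) k"
  by (simp add: shifts_def)

lemma conv_mprod_left:
  "mprod N X (\<lambda>x y. conv f (\<lambda>j. V j x y) k) x y = conv f (\<lambda>j. mprod N X (V j) x y) k"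
  unfolding conv_def mprod_def sum_distrib_left
  by (subst sum.swap) (simp add: mult_ac)

lemma conv_mprod_right:
  "mprod N (\<lambda>x y. conv f (\<lambda>j. V j x y) k) Y x y = conv f (\<lambda>j. mprod N (V j) Y x y) k"
  unfolding conv_def mprod_def sum_distrib_left sum_distrib_right
  by (subst sum.swap) (simp add: mult_ac)

lemma shifts_mprod_column:
  assumes X: "shifts N f X" and x: "x \<in> partitions_upto N" 
    and Y: "\<And>z. z \<in> partitions_upto N \<Longrightarrow> Y z y \<noteq> 0 \<Longrightarrow> sum_list z + k \<le> N"
  shows "mprod N (mprod N X (remove_hstrip k)) Y x y
    = conv f (\<lambda>j. mprod N (mprod N (remove_hstrip j) X) Y x y) k"
proof -
  have "mprod N (mprod N X (remove_hstrip k)) Y x y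
      = mprod N (\<lambda>x y. conv f (\<lambda>j. mprod N (remove_hstrip j) X x y) k) Y x y"
  proof (rule mprod_cong)
    fix z assume z: "z \<in> partitions_upto N"
    show "mprod N X (remove_hstrip k) x z * Y z y
        = conv f (\<lambda>j. mprod N (remove_hstrip j) X x z) k * Y z y"
      using shiftsD[OF X x z] Y[OF z] by (cases "Y z y = 0") auto
  qed
  also have "\<dots> = conv f (\<lambda>j. mprod N (mprod N (remove_hstrip j) X) Y x y) k"
    by (rule conv_mprod_right)
  finally show ?thesis .
qed

lemma shifts_mprod:
  assumes X: "shifts N f X" and Y: "shifts N g Y" and inc: "supported_on_containment Y"
  shows "shifts N (g * f) (mprod N X Y)"
  unfolding shifts_def
proof (intro ballI allI impI)
  fix x y k assume x: "x \<in> partitions_upto N" and y: "y \<in> partitions_upto N" and k: "sum_list y + k \<le> N"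
  have "mprod N (mprod N X Y) (remove_hstrip k) x y
      = mprod N X (\<lambda>x y. conv g (\<lambda>j. mprod N (remove_hstrip j) Y x y) k) x y"
    unfolding mprod_assoc using shiftsD[OF Y _ y k] by (intro mprod_cong) simp
  also have "\<dots> = conv g (\<lambda>j. mprod N (mprod N X (remove_hstrip j)) Y x y) k"
    by (simp add: conv_mprod_left mprod_assoc)
  also have "\<dots> = conv g (conv f (\<lambda>j. mprod N (remove_hstrip j) (mprod N X Y) x y)) k"
  proof (rule conv_cong)
    fix j assume "j \<le> k"
    then show "mprod N (mprod N X (remove_hstrip j)) Y x y
        = conv f (\<lambda>j. mprod N (remove_hstrip j) (mprod N X Y) x y) j"
      using shifts_mprod_column[OF X x, of Y y j] supported_on_containment_le[OF inc] k
      by (fastforce simp: mprod_assoc)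
  qed
  finally show "mprod N (mprod N X Y) (remove_hstrip k) x y
      = conv (g * f) (\<lambda>j. mprod N (remove_hstrip j) (mprod N X Y) x y) k"
    by (simp add: conv_conv)
qed

text \<open>
  Multiplying \<open>X U = f U X\<close> by \<open>Y\<close> on both sides gives \<open>U Y = f Y U\<close>, and \<open>f\<close> is moved to the other side
  by its inverse \<open>g\<close>.
\<close>

lemma shifts_inverse:
  assumes X: "shifts N f X" and inc: "supported_on_containment Y" and gf: "g * f = 1"
    and XY: "\<And>x y. x \<in> partitions_upto N \<Longrightarrow> y \<in> partitions_upto N \<Longrightarrow> mprod N X Y x y = ident x y"
    and YX: "\<And>x y. x \<in> partitions_upto N \<Longrightarrow> y \<in> partitions_upto N \<Longrightarrow> mprod N Y X x y = ident x y"
  shows "shifts N g Y"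
  unfolding shifts_def
proof (intro ballI allI impI)
  fix x y k assume x: "x \<in> partitions_upto N" and y: "y \<in> partitions_upto N" and k: "sum_list y + k \<le> N"
  have "conv g (\<lambda>j. mprod N (remove_hstrip j) Y x y) k
      = conv g (conv f (\<lambda>j. mprod N Y (remove_hstrip j) x y)) k"
  proof (rule conv_cong)
    fix j assume j: "j \<le> k"
    have "mprod N (remove_hstrip j) Y x y = mprod N ident (mprod N (remove_hstrip j) Y) x y"
      by (rule mprod_ident_left[OF x, symmetric])
    also have "\<dots> = mprod N (mprod N Y X) (mprod N (remove_hstrip j) Y) x y"
      by (rule mprod_cong) (simp add: YX[OF x])
    also have "\<dots> = mprod N Y (mprod N (mprod N X (remove_hstrip j)) Y) x y"
      by (simp add: mprod_assoc)
    also have "\<dots> = mprod N Y (\<lambda>x y. conv f (\<lambda>i. mprod N (mprod N (remove_hstrip i) X) Y x y) j) x y"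
    proof (rule mprod_cong)
      fix z assume z: "z \<in> partitions_upto N"
      have "sum_list w + j \<le> N" if "Y w y \<noteq> 0" for w
        using supported_on_containment_le[OF inc that] k j by simp
      then show "Y x z * mprod N (mprod N X (remove_hstrip j)) Y z y
          = Y x z * conv f (\<lambda>i. mprod N (mprod N (remove_hstrip i) X) Y z y) j"
        using shifts_mprod_column[OF X z, of Y y j] by simp
    qed
    also have "\<dots> = conv f (\<lambda>i. mprod N (mprod N Y (remove_hstrip i)) (mprod N X Y) x y) j"
      by (simp add: conv_mprod_left mprod_assoc)
    also have "\<dots> = conv f (\<lambda>i. mprod N Y (remove_hstrip i) x y) j"
    proof (rule conv_cong)
      fix i
      have "mprod N (mprod N Y (remove_hstrip i)) (mprod N X Y) x y
          = mprod N (mprod N Y (remove_hstrip i)) ident x y"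
        using XY[OF _ y] by (intro mprod_cong) simp
      then show "mprod N (mprod N Y (remove_hstrip i)) (mprod N X Y) x y
          = mprod N Y (remove_hstrip i) x y" by (simp add: mprod_ident_right[OF y])
    qed
    finally show "mprod N (remove_hstrip j) Y x y = conv f (\<lambda>j. mprod N Y (remove_hstrip j) x y) j" .
  qed
  also have "\<dots> = mprod N Y (remove_hstrip k) x y" by (simp add: conv_conv gf conv_1)
  finally show "mprod N Y (remove_hstrip k) x y = conv g (\<lambda>j. mprod N (remove_hstrip j) Y x y) k" ..
qed

text \<open>
  Both sides count, with the same weight, shapes that differ from \<open>x\<close> and \<open>y\<close> by horizontal strips:
  the left side shapes above both, the right side shapes below both, where the exponent \<open>i\<close> of the
  series is determined by the size of the lower shape.
\<close>

lemma shifts_add_hstrip: "shifts N (Abs_fps (\<lambda>i. a ^ i)) (add_hstrip a)"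
  unfolding shifts_def
proof (intro ballI allI impI)
  let ?Q = "partitions_upto N"
  fix x y k assume x: "x \<in> ?Q" and y: "y \<in> ?Q" and k: "sum_list y + k \<le> N"
  let ?R = "{rho. is_partition rho \<and> horizontal_strip rho x \<and> horizontal_strip rho y \<and>
            sum_list rho = sum_list y + k}"
  let ?V = "{nu. is_partition nu \<and> horizontal_strip x nu \<and> horizontal_strip y nu \<and>
            sum_list x \<le> sum_list nu + k}"
  let ?w = "a ^ (sum_list y + k - sum_list x)"
  have hs: "sum_list nu \<le> sum_list rho" if "horizontal_strip rho nu" for rho nu
    using that by (simp add: horizontal_strip_def contained_sum_le)
  have "mprod N (add_hstrip a) (remove_hstrip k) x y = (\<Sum>rho\<in>?R. ?w)"
    unfolding mprod_def
  proof (rule sum.mono_neutral_cong_right)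
    show "finite ?Q" by simp
  qed (use k in \<open>auto simp: partitions_upto_def add_hstrip_def remove_hstrip_def\<close>)
  also have "\<dots> = (\<Sum>nu\<in>?V. ?w)"
    using common_horizontal_strips[of x y k] x y by (simp add: partitions_upto_def)
  also have "\<dots> = (\<Sum>nu\<in>?Q. \<Sum>i\<le>k. a ^ i * (remove_hstrip (k - i) x nu * add_hstrip a nu y))"
  proof (rule sum.mono_neutral_cong_left)
    show "?V \<subseteq> ?Q" using x hs le_trans by (fastforce simp: partitions_upto_def)
    have term_eq: "a ^ i * (remove_hstrip (k - i) x nu * add_hstrip a nu y)
        = (if i = sum_list nu + k - sum_list x then
             (if nu \<in> ?V then ?w else 0) else 0)"
      if nu: "nu \<in> ?Q" and i: "i \<le> k" for nu i
    proof (cases "horizontal_strip x nu \<and> horizontal_strip y nu \<and> sum_list x = sum_list nu + (k - i)")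
      case True
      then have "i + (sum_list y - sum_list nu) = sum_list y + k - sum_list x"
        using hs[of y nu] i by linarith
      then have "a ^ i * a ^ (sum_list y - sum_list nu) = ?w"
        unfolding power_add[symmetric] by (rule arg_cong)
      then show ?thesis using True nu i
        by (auto simp: remove_hstrip_def add_hstrip_def partitions_upto_def)
    next
      case False
      then show ?thesis using nu i hs[of x nu]
        by (auto simp: remove_hstrip_def add_hstrip_def partitions_upto_def)
    qed
    have inner: "(\<Sum>i\<le>k. a ^ i * (remove_hstrip (k - i) x nu * add_hstrip a nu y))
        = (if nu \<in> ?V then ?w else 0)" if "nu \<in> ?Q" for nu
    proof -
      have "(\<Sum>i\<le>k. a ^ i * (remove_hstrip (k - i) x nu * add_hstrip a nu y))
          = (\<Sum>i\<le>k. if i = sum_list nu + k - sum_list x then (if nu \<in> ?V then ?w else 0) else 0)"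
        using term_eq[OF that] by (intro sum.cong) auto
      also have "\<dots> = (if nu \<in> ?V then ?w else 0)"
        using hs[of x nu] by (auto simp: sum.delta)
      finally show ?thesis .
    qed
    show "\<forall>nu\<in>?Q - ?V. (\<Sum>i\<le>k. a ^ i * (remove_hstrip (k - i) x nu * add_hstrip a nu y)) = 0"
      using inner by auto
    show "?w = (\<Sum>i\<le>k. a ^ i * (remove_hstrip (k - i) x nu * add_hstrip a nu y))"
      if "nu \<in> ?V" for nu
      using inner[of nu] that \<open>?V \<subseteq> ?Q\<close> by auto
  qed simp
  also have "\<dots> = conv (Abs_fps (\<lambda>i. a ^ i)) (\<lambda>j. mprod N (remove_hstrip j) (add_hstrip a) x y) k"
    unfolding conv_def mprod_def by (subst sum.swap) (simp add: sum_distrib_left)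
  finally show "mprod N (add_hstrip a) (remove_hstrip k) x y
    = conv (Abs_fps (\<lambda>i. a ^ i)) (\<lambda>j. mprod N (remove_hstrip j) (add_hstrip a) x y) k" .
qed


lemma geometric_fps_inverse: "(1 - fps_const a * fps_X) * Abs_fps (\<lambda>i. a ^ i) = (1 :: 'a::comm_ring_1 fps)"
proof (rule fps_ext)
  fix n
  show "fps_nth ((1 - fps_const a * fps_X) * Abs_fps (\<lambda>i. a ^ i)) n = fps_nth (1 :: 'a fps) n"
    by (cases n) (simp_all add: algebra_simps)
qed

text \<open>
  Adding vertical strips with parameter \<open>- a\<close> is inverse to adding horizontal strips with parameter
  \<open>a\<close>, so its commutation relation needs no separate bijection.
\<close>

lemma shifts_add_vstrip: "shifts N (1 - fps_const a * fps_X) (add_vstrip (- a))"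
  by (rule shifts_inverse[OF shifts_add_hstrip supported_on_containment_add_vstrip geometric_fps_inverse
        add_hstrip_vstrip_inverse add_vstrip_hstrip_inverse])

lemma ribbon_series_coeff:
  "fps_nth ((1 - fps_const a * fps_X) * Abs_fps (\<lambda>_. 1 :: 'a::comm_ring_1)) i = (if i = 0 then 1 else 1 - a)"
  by (cases i) (simp_all add: algebra_simps)

lemma supported_on_containment_mprod:
  assumes "supported_on_containment X" "supported_on_containment Y"
  shows "supported_on_containment (mprod N X Y)"
  unfolding supported_on_containment_def
proof (intro allI impI)
  fix x y assume "mprod N X Y x y \<noteq> 0"
  then obtain z where "X x z * Y z y \<noteq> 0"
    unfolding mprod_def by (meson sum.neutral)
  then have "X x z \<noteq> 0" "Y z y \<noteq> 0" by auto
  then have "contained x z" "contained z y" using assms by (auto simp: supported_on_containment_def)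
  then show "contained x y" by (rule contained_trans)
qed

text \<open>
  By the computation of the sums over intermediate shapes, the entries of this product are the
  weights of broken ribbons.
\<close>

definition add_ribbons :: "nat \<Rightarrow> 'a::comm_ring_1 \<Rightarrow> 'a \<Rightarrow> 'a pmatrix" where
  "add_ribbons N a b = mprod N (add_hstrip a) (add_vstrip b)"

text \<open>
  Write \<open>H(a)\<close> and \<open>E(b)\<close> for the matrices that add horizontal and vertical strips.  In
  \<open>H(a) E(- b) H(b) E(- a)\<close> first the two inner and then the two outer factors cancel.
\<close>

lemma add_ribbons_inverse:
  assumes "x \<in> partitions_upto N" "y \<in> partitions_upto N"
  shows "mprod N (add_ribbons N a (- b)) (add_ribbons N b (- a)) x y = ident x y"
proof -
  have "mprod N (add_ribbons N a (- b)) (add_ribbons N b (- a)) x y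
      = mprod N (add_hstrip a) (mprod N (mprod N (add_vstrip (- b)) (add_hstrip b)) (add_vstrip (- a))) x y"
    by (simp add: add_ribbons_def mprod_assoc)
  also have "\<dots> = mprod N (add_hstrip a) (mprod N ident (add_vstrip (- a))) x y"
  proof (rule mprod_cong)
    fix z assume z: "z \<in> partitions_upto N"
    have "mprod N (mprod N (add_vstrip (- b)) (add_hstrip b)) (add_vstrip (- a)) z y
        = mprod N ident (add_vstrip (- a)) z y"
      by (rule mprod_cong) (simp add: add_vstrip_hstrip_inverse z)
    then show "add_hstrip a x z * mprod N (mprod N (add_vstrip (- b)) (add_hstrip b)) (add_vstrip (- a)) z y
        = add_hstrip a x z * mprod N ident (add_vstrip (- a)) z y" by simp
  qed
  also have "\<dots> = mprod N (add_hstrip a) (add_vstrip (- a)) x y"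
    by (rule mprod_cong) (simp add: mprod_ident_left)
  also have "\<dots> = ident x y" by (rule add_hstrip_vstrip_inverse[OF assms])
  finally show ?thesis .
qed

lemma shifts_add_ribbons:
  "shifts N ((1 - fps_const b * fps_X) * Abs_fps (\<lambda>_. 1)) (add_ribbons N 1 (- b))"
  using shifts_mprod[OF shifts_add_hstrip[of N 1] shifts_add_vstrip[of N b] supported_on_containment_add_vstrip]
  by (simp add: add_ribbons_def)

section \<open>Skew Schur functions as matrices\<close>

text \<open>
  The skew diagram of two partitions that are not nested need not be empty, so the entry for such a
  pair is set to zero explicitly; only then is the branching rule a matrix identity.
\<close>

definition schur_coeff :: "(nat \<Rightarrow>\<^sub>0 nat) \<Rightarrow> 'a::comm_ring_1 pmatrix" where
  "schur_coeff \<alpha> lam mu = (if contained mu lam then of_nat (card (tableaux lam mu \<alpha>)) else 0)"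

lemma schur_coeff_nonzero:
  assumes "schur_coeff \<alpha> x y \<noteq> 0"
  shows "sum_list x = sum_list y + degree_of \<alpha>"
proof -
  have "contained y x" "card (tableaux x y \<alpha>) \<noteq> 0"
    using assms by (auto simp: schur_coeff_def split: if_splits)
  then show ?thesis by (intro tableaux_degree) auto
qed

lemma schur_coeff_0:
  assumes "is_partition x" "is_partition y"
  shows "schur_coeff 0 x y = ident x y"
proof (cases "x = y")
  case True
  then show ?thesis by (simp add: schur_coeff_def ident_def tableaux_same)
next
  case False
  then have "\<not> (contained y x \<and> sum_list x = sum_list y)"
    using contained_sum_eq[OF assms] by auto
  then have "schur_coeff 0 x y = (0 :: 'a)"
  proof (rule contrapos_np)
    assume nz: "schur_coeff 0 x y \<noteq> (0 :: 'a)"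
    show "contained y x \<and> sum_list x = sum_list y"
      using schur_coeff_nonzero[OF nz] nz by (auto simp: schur_coeff_def split: if_splits)
  qed
  then show ?thesis using False by (simp add: ident_def)
qed

lemma schur_coeff_add_variable:
  assumes x: "x \<in> partitions_upto N" and y: "is_partition y"
    and keys: "Poly_Mapping.keys \<beta> \<subseteq> {..<n}"
  shows "schur_coeff (\<beta> + Poly_Mapping.single n k) x y
    = mprod N (remove_hstrip k) (schur_coeff \<beta>) x y"
proof -
  let ?V = "{nu. is_partition nu \<and> horizontal_strip x nu \<and> contained y nu \<and>
          sum_list x = sum_list nu + k}"
  have sub: "?V \<subseteq> partitions_upto N" using x by (auto simp: partitions_upto_def)
  have p: "is_partition x" using x by (simp add: partitions_upto_def)
  have "schur_coeff (\<beta> + Poly_Mapping.single n k) x y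
      = (\<Sum>nu\<in>?V. of_nat (card (tableaux nu y \<beta>)) :: 'a)"
  proof (cases "contained y x")
    case True
    then show ?thesis
      unfolding schur_coeff_def card_tableaux_recursion[OF p y True keys] by simp
  next
    case False
    then have V0: "?V = {}"
      using contained_trans unfolding horizontal_strip_def by blast
    show ?thesis unfolding V0 using False by (simp add: schur_coeff_def)
  qed
  also have "\<dots> = mprod N (remove_hstrip k) (schur_coeff \<beta>) x y"
    unfolding mprod_def
  proof (rule sum.mono_neutral_cong_left[OF _ sub])
    show "\<forall>i\<in>partitions_upto N - ?V. remove_hstrip k x i * schur_coeff \<beta> i y = (0::'a)"
      by (auto simp: partitions_upto_def remove_hstrip_def schur_coeff_def)
    show "of_nat (card (tableaux nu y \<beta>)) = remove_hstrip k x nu * (schur_coeff \<beta> nu y :: 'a)"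
      if "nu \<in> ?V" for nu
      using that by (simp add: remove_hstrip_def schur_coeff_def)
  qed simp
  finally show ?thesis .
qed

text \<open>
  The coefficient of the monomial \<open>\<gamma>\<close> in the product of the series \<open>f\<close> over all variables, when \<open>f\<close>
  has constant term one.
\<close>

definition factor_coeff :: "'a::comm_ring_1 fps \<Rightarrow> (nat \<Rightarrow>\<^sub>0 nat) \<Rightarrow> 'a" where
  "factor_coeff f \<gamma> = (\<Prod>i\<in>Poly_Mapping.keys \<gamma>. fps_nth f (Poly_Mapping.lookup \<gamma> i))"

lemma factor_coeff_add_single:
  assumes "fps_nth f 0 = 1" "n \<notin> Poly_Mapping.keys \<gamma>"
  shows "factor_coeff f (\<gamma> + Poly_Mapping.single n i) = fps_nth f i * factor_coeff f \<gamma>"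
proof -
  have sup: "factor_coeff f \<delta> = (\<Prod>i\<in>A. fps_nth f (Poly_Mapping.lookup \<delta> i))"
    if "finite A" "Poly_Mapping.keys \<delta> \<subseteq> A" for A \<delta>
    unfolding factor_coeff_def using that assms(1)
    by (intro prod.mono_neutral_left) (auto simp: in_keys_iff)
  have k: "Poly_Mapping.keys (\<gamma> + Poly_Mapping.single n i) \<subseteq> insert n (Poly_Mapping.keys \<gamma>)"
    using keys_add[of \<gamma> "Poly_Mapping.single n i"] by (auto split: if_splits)
  have "factor_coeff f (\<gamma> + Poly_Mapping.single n i)
      = fps_nth f (Poly_Mapping.lookup \<gamma> n + i) *
        (\<Prod>m\<in>Poly_Mapping.keys \<gamma>. fps_nth f (Poly_Mapping.lookup (\<gamma> + Poly_Mapping.single n i) m))"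
    using assms(2) by (subst sup[OF _ k]) (simp_all add: lookup_add)
  also have "(\<Prod>m\<in>Poly_Mapping.keys \<gamma>. fps_nth f (Poly_Mapping.lookup (\<gamma> + Poly_Mapping.single n i) m))
      = factor_coeff f \<gamma>"
    unfolding factor_coeff_def using assms(2)
    by (intro prod.cong refl) (auto simp: lookup_add lookup_single when_def)
  also have "Poly_Mapping.lookup \<gamma> n = 0" using assms(2) by (simp add: in_keys_iff)
  finally show ?thesis by simp
qed

lemma split_off_variable:
  "\<alpha> = Poly_Mapping.update n 0 \<alpha> + Poly_Mapping.single n (Poly_Mapping.lookup \<alpha> n)"
  by (rule poly_mapping_eqI) (simp add: lookup_add lookup_update lookup_single when_def)

lemma keys_update_0: "Poly_Mapping.keys (Poly_Mapping.update n 0 \<alpha>) = Poly_Mapping.keys \<alpha> - {n}"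
  by (auto simp: in_keys_iff lookup_update split: if_splits)

lemma sum_antidiag_add_single:
  assumes n: "n \<notin> Poly_Mapping.keys \<alpha>"
  shows "(\<Sum>p\<in>antidiag (\<alpha> + Poly_Mapping.single n k). h p)
    = (\<Sum>i\<le>k. \<Sum>(\<beta>, \<gamma>)\<in>antidiag \<alpha>.
        h (\<beta> + Poly_Mapping.single n (k - i), \<gamma> + Poly_Mapping.single n i))"
proof -
  let ?u = "Poly_Mapping.update n 0" and ?s = "Poly_Mapping.single n"
  have n0: "Poly_Mapping.lookup \<alpha> n = 0" using n by (simp add: in_keys_iff)
  have "(\<Sum>(i, p)\<in>{..k} \<times> antidiag \<alpha>. h (fst p + ?s (k - i), snd p + ?s i))
      = (\<Sum>p\<in>antidiag (\<alpha> + ?s k). h p)"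
  proof (rule sum.reindex_bij_witness
      [where i = "\<lambda>(\<beta>, \<gamma>). (Poly_Mapping.lookup \<gamma> n, (?u \<beta>, ?u \<gamma>))"
         and j = "\<lambda>(i, p). (fst p + ?s (k - i), snd p + ?s i)"])
    fix a assume a: "a \<in> {..k} \<times> antidiag \<alpha>"
    then obtain i \<beta> \<gamma> where ab: "a = (i, (\<beta>, \<gamma>))" "i \<le> k" "\<beta> + \<gamma> = \<alpha>"
      by (auto simp: antidiag_def)
    have z: "Poly_Mapping.lookup \<beta> n = 0" "Poly_Mapping.lookup \<gamma> n = 0"
      using n0 unfolding ab(3)[symmetric] lookup_add by simp_all
    have u: "?u (\<delta> + ?s m) = \<delta>" if "Poly_Mapping.lookup \<delta> n = 0" for \<delta> m
      using that
      by (intro poly_mapping_eqI) (auto simp: lookup_add lookup_update lookup_single when_def)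
    show "(case case a of (i, p) \<Rightarrow> (fst p + ?s (k - i), snd p + ?s i) of
        (\<beta>, \<gamma>) \<Rightarrow> (Poly_Mapping.lookup \<gamma> n, (?u \<beta>, ?u \<gamma>))) = a"
      using z by (simp add: ab u lookup_add)
    have "\<beta> + ?s (k - i) + (\<gamma> + ?s i) = \<alpha> + ?s k"
      using ab(2) by (simp add: ab(3)[symmetric] ac_simps single_add[symmetric])
    then show "(case a of (i, p) \<Rightarrow> (fst p + ?s (k - i), snd p + ?s i)) \<in> antidiag (\<alpha> + ?s k)"
      by (simp add: ab antidiag_def)
  next
    fix b assume "b \<in> antidiag (\<alpha> + ?s k)"
    then obtain \<beta> \<gamma> where b: "b = (\<beta>, \<gamma>)" and sum: "\<beta> + \<gamma> = \<alpha> + ?s k"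
      by (auto simp: antidiag_def)
    have l: "Poly_Mapping.lookup \<beta> m + Poly_Mapping.lookup \<gamma> m
        = Poly_Mapping.lookup \<alpha> m + (if m = n then k else 0)" for m
      using arg_cong[OF sum, of "\<lambda>p. Poly_Mapping.lookup p m"]
      by (simp add: lookup_add lookup_single when_def eq_commute)
    have k: "k = Poly_Mapping.lookup \<beta> n + Poly_Mapping.lookup \<gamma> n" using l[of n] n0 by simp
    have "?u \<beta> + ?u \<gamma> = \<alpha>"
    proof (rule poly_mapping_eqI)
      show "Poly_Mapping.lookup (?u \<beta> + ?u \<gamma>) m = Poly_Mapping.lookup \<alpha> m" for m
        using l[of m] n0 by (auto simp: lookup_add lookup_update)
    qed
    then show "(case b of (\<beta>, \<gamma>) \<Rightarrow> (Poly_Mapping.lookup \<gamma> n, (?u \<beta>, ?u \<gamma>))) \<in> {..k} \<times> antidiag \<alpha>"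
      using k by (simp add: b antidiag_def)
    show "(case case b of (\<beta>, \<gamma>) \<Rightarrow> (Poly_Mapping.lookup \<gamma> n, (?u \<beta>, ?u \<gamma>)) of
        (i, p) \<Rightarrow> (fst p + ?s (k - i), snd p + ?s i)) = b"
      using split_off_variable[of \<beta> n] split_off_variable[of \<gamma> n] k by (simp add: b)
  qed auto
  then show ?thesis by (simp add: sum.cartesian_product split_def)
qed

lemma antidiag_0: "antidiag 0 = {(0, 0)}"
proof -
  have "\<beta> = 0 \<and> \<gamma> = 0" if "\<beta> + \<gamma> = 0" for \<beta> \<gamma> :: "nat \<Rightarrow>\<^sub>0 nat"
  proof -
    have "Poly_Mapping.lookup \<beta> i + Poly_Mapping.lookup \<gamma> i = 0" for i
      using arg_cong[OF that, of "\<lambda>p. Poly_Mapping.lookup p i"] by (simp add: lookup_add)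
    then show ?thesis by (auto intro!: poly_mapping_eqI)
  qed
  note zero = this
  show ?thesis
  proof (intro equalityI subsetI)
    fix p assume p: "p \<in> antidiag (0 :: nat \<Rightarrow>\<^sub>0 nat)"
    obtain \<beta> \<gamma> where p': "p = (\<beta>, \<gamma>)" by (cases p)
    have "\<beta> + \<gamma> = 0" using p unfolding p' antidiag_def by simp
    from zero[OF this] show "p \<in> {(0, 0)}" by (simp add: p')
  qed (simp add: antidiag_def)
qed

section \<open>Multiplication by a quantum power sum\<close>

text \<open>
  If moving \<open>A\<close> past one variable costs the factor \<open>f\<close>, then moving it past a whole skew Schur function
  costs the product of \<open>f\<close> over all variables.  The induction removes the variables one at a time.
\<close>

lemma shifts_schur_coeff:
  assumes A: "shifts N f A" and f0: "fps_nth f 0 = 1"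
    and x: "x \<in> partitions_upto N" and y: "y \<in> partitions_upto N"
    and size: "sum_list y + degree_of \<alpha> \<le> N"
  shows "mprod N A (schur_coeff \<alpha>) x y
    = (\<Sum>(\<beta>, \<gamma>)\<in>antidiag \<alpha>. factor_coeff f \<gamma> * mprod N (schur_coeff \<beta>) A x y)"
proof -
  have py: "is_partition y" using y by (simp add: partitions_upto_def)
  obtain n where "Poly_Mapping.keys \<alpha> \<subseteq> {..<n}"
    using finite_nat_iff_bounded[of "Poly_Mapping.keys \<alpha>"] by auto
  then show ?thesis using size x
  proof (induction n arbitrary: \<alpha> x)
    case 0
    then have \<alpha>: "\<alpha> = 0" by simp
    have "mprod N A (schur_coeff 0) x y = mprod N A ident x y"
      by (rule mprod_cong) (use py in \<open>auto simp: schur_coeff_0 partitions_upto_def\<close>)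
    moreover have "mprod N (schur_coeff 0) A x y = mprod N ident A x y"
      by (rule mprod_cong) (use 0 in \<open>auto simp: schur_coeff_0 partitions_upto_def\<close>)
    ultimately show ?case
      using 0 y by (simp add: \<alpha> antidiag_0 factor_coeff_def mprod_ident_left mprod_ident_right)
  next
    case (Suc n)
    define k where "k = Poly_Mapping.lookup \<alpha> n"
    define \<alpha>' where "\<alpha>' = Poly_Mapping.update n 0 \<alpha>"
    let ?s = "Poly_Mapping.single n"
    have \<alpha>: "\<alpha> = \<alpha>' + ?s k" unfolding \<alpha>'_def k_def by (rule split_off_variable)
    have keys: "Poly_Mapping.keys \<alpha>' \<subseteq> {..<n}" "n \<notin> Poly_Mapping.keys \<alpha>'"
      using Suc.prems(1) by (auto simp: \<alpha>'_def keys_update_0 less_Suc_eq)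
    have size': "sum_list y + degree_of \<alpha>' + k \<le> N"
      using Suc.prems(2) by (simp add: \<alpha> degree_of_add)
    have parts: "Poly_Mapping.keys \<beta> \<subseteq> {..<n}" "Poly_Mapping.keys \<gamma> \<subseteq> {..<n}"
      if "(\<beta>, \<gamma>) \<in> antidiag \<alpha>'" for \<beta> \<gamma>
    proof -
      have "\<beta> + \<gamma> = \<alpha>'" using that by (simp add: antidiag_def)
      then have "Poly_Mapping.lookup \<alpha>' i = Poly_Mapping.lookup \<beta> i + Poly_Mapping.lookup \<gamma> i" for i
        by (auto simp: lookup_add)
      then have "Poly_Mapping.keys \<beta> \<subseteq> Poly_Mapping.keys \<alpha>'" "Poly_Mapping.keys \<gamma> \<subseteq> Poly_Mapping.keys \<alpha>'"
        by (auto simp: in_keys_iff)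
      then show "Poly_Mapping.keys \<beta> \<subseteq> {..<n}" "Poly_Mapping.keys \<gamma> \<subseteq> {..<n}" using keys by auto
    qed
    have IH: "mprod N A (schur_coeff \<alpha>') z y
        = (\<Sum>(\<beta>, \<gamma>)\<in>antidiag \<alpha>'. factor_coeff f \<gamma> * mprod N (schur_coeff \<beta>) A z y)"
      if "z \<in> partitions_upto N" for z
      using Suc.IH[OF keys(1) _ that] size' by simp
    have step: "mprod N (remove_hstrip j) (mprod N A (schur_coeff \<alpha>')) x y
        = (\<Sum>(\<beta>, \<gamma>)\<in>antidiag \<alpha>'. factor_coeff f \<gamma> * mprod N (schur_coeff (\<beta> + ?s j)) A x y)" for j
    proof -
      have "mprod N (remove_hstrip j) (mprod N A (schur_coeff \<alpha>')) x y
          = mprod N (remove_hstrip j) (\<lambda>z y. \<Sum>(\<beta>, \<gamma>)\<in>antidiag \<alpha>'.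
              factor_coeff f \<gamma> * mprod N (schur_coeff \<beta>) A z y) x y"
        using IH by (intro mprod_cong) simp
      also have "\<dots> = (\<Sum>(\<beta>, \<gamma>)\<in>antidiag \<alpha>'.
          factor_coeff f \<gamma> * mprod N (remove_hstrip j) (mprod N (schur_coeff \<beta>) A) x y)"
        unfolding mprod_def[of N "remove_hstrip j"] split_def sum_distrib_left
        by (subst sum.swap) (simp add: mult_ac)
      also have "\<dots> = (\<Sum>(\<beta>, \<gamma>)\<in>antidiag \<alpha>'.
          factor_coeff f \<gamma> * mprod N (schur_coeff (\<beta> + ?s j)) A x y)"
      proof (intro sum.cong refl, clarify)
        fix \<beta> \<gamma> assume "(\<beta>, \<gamma>) \<in> antidiag \<alpha>'"
        note k = parts(1)[OF this]
        have "mprod N (schur_coeff (\<beta> + ?s j)) A x y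
            = mprod N (mprod N (remove_hstrip j) (schur_coeff \<beta>)) A x y"
          by (rule mprod_cong)
             (simp add: schur_coeff_add_variable[OF Suc.prems(3) _ k] partitions_upto_def)
        then show "factor_coeff f \<gamma> * mprod N (remove_hstrip j) (mprod N (schur_coeff \<beta>) A) x y
            = factor_coeff f \<gamma> * mprod N (schur_coeff (\<beta> + ?s j)) A x y"
          by (simp add: mprod_assoc)
      qed
      finally show ?thesis .
    qed
    have "mprod N A (schur_coeff \<alpha>) x y = mprod N A (mprod N (remove_hstrip k) (schur_coeff \<alpha>')) x y"
      unfolding \<alpha> by (rule mprod_cong) (simp add: schur_coeff_add_variable[OF _ py keys(1)])
    also have "\<dots> = mprod N (mprod N A (remove_hstrip k)) (schur_coeff \<alpha>') x y"
      by (simp add: mprod_assoc)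
    also have "\<dots> = conv f (\<lambda>j. mprod N (remove_hstrip j) (mprod N A (schur_coeff \<alpha>')) x y) k"
    proof -
      have "sum_list z + k \<le> N" if "schur_coeff \<alpha>' z y \<noteq> (0 :: 'a)" for z
        using schur_coeff_nonzero[OF that] size' by simp
      then show ?thesis
        using shifts_mprod_column[OF A Suc.prems(3), of "schur_coeff \<alpha>'" y k]
        by (simp add: mprod_assoc)
    qed
    also have "\<dots> = (\<Sum>i\<le>k. \<Sum>(\<beta>, \<gamma>)\<in>antidiag \<alpha>'.
        factor_coeff f (\<gamma> + ?s i) * mprod N (schur_coeff (\<beta> + ?s (k - i))) A x y)"
      unfolding conv_def step sum_distrib_left
    proof (intro sum.cong refl, clarify)
      fix i \<beta> \<gamma> assume "(\<beta>, \<gamma>) \<in> antidiag \<alpha>'"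
      then have "n \<notin> Poly_Mapping.keys \<gamma>" using parts(2)[of \<beta> \<gamma>] by auto
      then show "fps_nth f i * (factor_coeff f \<gamma> * mprod N (schur_coeff (\<beta> + ?s (k - i))) A x y)
          = factor_coeff f (\<gamma> + ?s i) * mprod N (schur_coeff (\<beta> + ?s (k - i))) A x y"
        by (simp add: factor_coeff_add_single[OF f0] mult_ac)
    qed
    also have "\<dots> = (\<Sum>(\<beta>, \<gamma>)\<in>antidiag \<alpha>. factor_coeff f \<gamma> * mprod N (schur_coeff \<beta>) A x y)"
      unfolding \<alpha> by (subst sum_antidiag_add_single[OF keys(2)]) simp
    finally show ?case .
  qed
qed

lemma factor_coeff_ribbon_series:
  "factor_coeff ((1 - fps_const a * fps_X) * Abs_fps (\<lambda>_. 1 :: 'a::comm_ring_1)) \<gamma>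
    = (1 - a) ^ card (Poly_Mapping.keys \<gamma>)"
proof -
  have "factor_coeff ((1 - fps_const a * fps_X) * Abs_fps (\<lambda>_. 1 :: 'a)) \<gamma>
      = (\<Prod>i\<in>Poly_Mapping.keys \<gamma>. 1 - a)"
    unfolding factor_coeff_def
  proof (rule prod.cong)
    fix i assume "i \<in> Poly_Mapping.keys \<gamma>"
    then have "Poly_Mapping.lookup \<gamma> i \<noteq> 0" by (simp only: in_keys_iff not_False_eq_True)
    then show "fps_nth ((1 - fps_const a * fps_X) * Abs_fps (\<lambda>_. 1 :: 'a)) (Poly_Mapping.lookup \<gamma> i)
        = 1 - a"
      by (simp only: ribbon_series_coeff if_False)
  qed simp
  then show ?thesis by simp
qed

text \<open>
  Write \<open>S\<close> for the matrix of skew Schur functions, \<open>A\<close> and \<open>A'\<close> for the two mutually inverse ribbon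
  matrices and \<open>F\<close> for the product of \<open>(1 - b x) / (1 - x)\<close> over all variables.  The relation
  \<open>A S = F S A\<close> gives \<open>F S = A S A'\<close>, whose coefficients are compared here.
\<close>

lemma schur_coeff_ribbon_conjugation:
  assumes x: "x \<in> partitions_upto N" and y: "y \<in> partitions_upto N"
    and size: "sum_list y + degree_of \<alpha> \<le> N"
  shows "(\<Sum>(\<beta>, \<gamma>)\<in>antidiag \<alpha>. (1 - b) ^ card (Poly_Mapping.keys \<gamma>) * schur_coeff \<beta> x y)
    = (\<Sum>(rho, nu)\<in>partitions_upto N \<times> partitions_upto N.
        ribbon_weight 1 (- b) x rho * schur_coeff \<alpha> rho nu * ribbon_weight b (- 1) nu y)"
    (is "?L = ?R")
proof -
  let ?Q = "partitions_upto N"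
  let ?A = "add_ribbons N 1 (- b)" and ?B = "add_ribbons N b (- 1)"
  let ?f = "\<lambda>\<gamma>. (1 - b) ^ card (Poly_Mapping.keys \<gamma>)"
  have inc: "supported_on_containment ?B"
    unfolding add_ribbons_def
    by (intro supported_on_containment_mprod supported_on_containment_add_hstrip supported_on_containment_add_vstrip)
  have "?R = (\<Sum>(rho, nu)\<in>?Q \<times> ?Q. ?A x rho * schur_coeff \<alpha> rho nu * ?B nu y)"
    by (intro sum.cong) (auto simp: add_ribbons_def add_hstrip_vstrip x y)
  also have "\<dots> = (\<Sum>rho\<in>?Q. \<Sum>nu\<in>?Q. ?A x rho * schur_coeff \<alpha> rho nu * ?B nu y)"
    by (rule sum.cartesian_product[symmetric])
  also have "\<dots> = (\<Sum>nu\<in>?Q. \<Sum>rho\<in>?Q. ?A x rho * schur_coeff \<alpha> rho nu * ?B nu y)"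
    by (rule sum.swap)
  also have "\<dots> = mprod N (mprod N ?A (schur_coeff \<alpha>)) ?B x y"
    by (simp add: mprod_def sum_distrib_right)
  also have "\<dots> = mprod N (\<lambda>x z. \<Sum>(\<beta>, \<gamma>)\<in>antidiag \<alpha>. ?f \<gamma> * mprod N (schur_coeff \<beta>) ?A x z) ?B x y"
  proof (rule mprod_cong)
    fix z assume z: "z \<in> ?Q"
    show "mprod N ?A (schur_coeff \<alpha>) x z * ?B z y
        = (\<Sum>(\<beta>, \<gamma>)\<in>antidiag \<alpha>. ?f \<gamma> * mprod N (schur_coeff \<beta>) ?A x z) * ?B z y"
    proof (cases "?B z y = 0")
      case False
      then have "sum_list z + degree_of \<alpha> \<le> N"
        using supported_on_containment_le[OF inc False] size by simp
      then show ?thesis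
        by (simp add: shifts_schur_coeff[OF shifts_add_ribbons _ x z] factor_coeff_ribbon_series)
    qed simp
  qed
  also have "\<dots> = (\<Sum>(\<beta>, \<gamma>)\<in>antidiag \<alpha>. ?f \<gamma> * mprod N (mprod N (schur_coeff \<beta>) ?A) ?B x y)"
    unfolding mprod_def[of N _ ?B] split_def sum_distrib_right sum_distrib_left
    by (subst sum.swap) (simp add: mult_ac)
  also have "\<dots> = ?L"
  proof (intro sum.cong refl, clarify)
    fix \<beta> \<gamma>
    have "mprod N (mprod N (schur_coeff \<beta>) ?A) ?B x y = mprod N (schur_coeff \<beta>) ident x y"
      unfolding mprod_assoc
      by (rule mprod_cong) (simp add: add_ribbons_inverse y)
    then show "?f \<gamma> * mprod N (mprod N (schur_coeff \<beta>) ?A) ?B x y = ?f \<gamma> * schur_coeff \<beta> x y"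
      by (simp add: mprod_ident_right y)
  qed
  finally show ?thesis ..
qed

text \<open>
  The exponent \<open>r + 1 - j\<close> of the expansion is one more than the size of the outer broken ribbon, which
  is width plus height plus number of components.  The width cancels, the height turns \<open>q\<close> into
  \<open>- q\<close>, and the components turn \<open>q - 1\<close> into \<open>1 - q\<close>.
\<close>

lemma ribbon_sign:
  assumes "is_partition rho" "is_partition lam" "is_partition mu" "is_partition nu"
    and "is_broken_ribbon rho lam" "is_broken_ribbon mu nu"
  shows "(-1) ^ Suc (sum_list rho - sum_list lam) *
      ((-1) ^ (wt rho lam + ht mu nu) * q ^ (ht rho lam + wt mu nu) *
       (q - 1) powi (int (rib rho lam) + int (rib mu nu) - 1))
    = - inverse (q - 1) * (ribbon_weight 1 (- q) lam rho * ribbon_weight q (- 1) nu mu)"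
proof -
  have "sum_list rho - sum_list lam = wt rho lam + ht rho lam + rib rho lam"
    using size_eq_wt_ht_rib(1)[OF assms(1,2,5)] by simp
  moreover have "(q - 1) powi (int (rib rho lam) + int (rib mu nu) - 1)
      = inverse (q - 1) * (q - 1) ^ rib rho lam * (q - 1) ^ rib mu nu"
    using q_neq_1 by (simp add: power_int_diff power_int_add field_simps)
  moreover have "(1 - q) ^ rib rho lam = (-1) ^ rib rho lam * (q - 1) ^ rib rho lam"
    by (simp add: power_mult_distrib[symmetric])
  moreover have "(- q) ^ ht rho lam = (-1) ^ ht rho lam * q ^ ht rho lam"
    by (rule power_minus)
  ultimately show ?thesis
    using assms(5,6) by (simp add: ribbon_weight_def power_add mult_ac)
qed

lemma mcoeff_times: "mcoeff (f * g) \<alpha> = (\<Sum>(\<beta>, \<gamma>)\<in>antidiag \<alpha>. mcoeff f \<beta> * mcoeff g \<gamma>)"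
  by (simp add: times_mfps.rep_eq)

theorem theorem4:
  fixes lam mu :: "nat list" and r :: nat
  assumes "is_partition lam" and "is_partition mu" and "contained mu lam"
  shows "skew_schur lam mu * quantum_power_sum r =
    (\<Sum>j = 0..r. mscale ((-1) ^ (r + 1 - j))
      (\<Sum>(lam_p, mu_m) \<in> ribbon_pairs lam mu (r - j) j.
         mscale ((-1) ^ (wt lam_p lam + ht mu mu_m) *
                 q ^ (ht lam_p lam + wt mu mu_m) *
                 (q - 1) powi (int (rib lam_p lam) + int (rib mu mu_m) - 1))
           (skew_schur lam_p mu_m)))"
    (is "_ = ?rhs")
proof (rule mfps_eqI)
  fix \<alpha>
  let ?P = "\<lambda>j. ribbon_pairs lam mu (r - j) j"
  let ?c = "\<lambda>rho nu. (-1) ^ (wt rho lam + ht mu nu) * q ^ (ht rho lam + wt mu nu) *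
                 (q - 1) powi (int (rib rho lam) + int (rib mu nu) - 1)"
  have sub: "contained nu rho" if "(rho, nu) \<in> ?P j" for rho nu j
    using that assms(3) contained_trans unfolding ribbon_pairs_def by blast
  have rhs: "mcoeff ?rhs \<alpha> = (\<Sum>j=0..r. \<Sum>(rho, nu)\<in>?P j.
      (-1) ^ (r + 1 - j) * (?c rho nu * schur_coeff \<alpha> rho nu))"
    unfolding mcoeff_sum mscale.rep_eq sum_distrib_left
    by (intro sum.cong refl)
       (auto simp: mscale.rep_eq mcoeff_skew_schur schur_coeff_def dest: sub)
  have deg: "degree_of \<alpha> = degree_of \<beta> + degree_of \<gamma>" if "(\<beta>, \<gamma>) \<in> antidiag \<alpha>" for \<beta> \<gamma>
    using that by (auto simp: antidiag_def degree_of_add)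
  have lhs: "mcoeff (skew_schur lam mu * quantum_power_sum r) \<alpha>
    = (\<Sum>(\<beta>, \<gamma>)\<in>antidiag \<alpha>. schur_coeff \<beta> lam mu *
        (if degree_of \<gamma> = r then - inverse (q - 1) * (1 - q) ^ card (Poly_Mapping.keys \<gamma>) else 0))"
    using assms(3) by (simp add: mcoeff_times mcoeff_skew_schur mcoeff_quantum_power_sum schur_coeff_def)
  show "mcoeff (skew_schur lam mu * quantum_power_sum r) \<alpha> = mcoeff ?rhs \<alpha>"
  proof (cases "sum_list lam + r = sum_list mu + degree_of \<alpha>")
    case False
    have "schur_coeff \<beta> lam mu *
        (if degree_of \<gamma> = r then - inverse (q - 1) * (1 - q) ^ card (Poly_Mapping.keys \<gamma>) else 0) = 0"
      if "(\<beta>, \<gamma>) \<in> antidiag \<alpha>" for \<beta> \<gamma>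
      using schur_coeff_nonzero[of \<beta> lam mu, where 'a = qfield] deg[OF that] False by fastforce
    then have "mcoeff (skew_schur lam mu * quantum_power_sum r) \<alpha> = 0"
      unfolding lhs by (intro sum.neutral) auto
    moreover have "schur_coeff \<alpha> rho nu = (0 :: qfield)" if "(rho, nu) \<in> ?P j" "j \<le> r" for rho nu j
    proof (rule ccontr)
      assume "schur_coeff \<alpha> rho nu \<noteq> (0 :: qfield)"
      then have "sum_list rho = sum_list nu + degree_of \<alpha>" by (rule schur_coeff_nonzero)
      moreover have "sum_list rho = sum_list lam + (r - j)" "sum_list mu = sum_list nu + j"
        using that contained_sum_le[of lam rho] contained_sum_le[of nu mu]
        by (auto simp: ribbon_pairs_def skew_size_def)
      ultimately show False using False that(2) by simp
    qed
    then have "mcoeff ?rhs \<alpha> = 0"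
      unfolding rhs by (intro sum.neutral ballI) auto
    ultimately show ?thesis by simp
  next
    case True
    \<comment> \<open>large enough for every outer shape: these have size \<open>sum_list nu + degree_of \<alpha>\<close>\<close>
    define N where "N = sum_list lam + sum_list mu + degree_of \<alpha>"
    let ?Q = "partitions_upto N"
    let ?G = "\<lambda>rho nu. ribbon_weight 1 (- q) lam rho * schur_coeff \<alpha> rho nu * ribbon_weight q (- 1) nu mu"
    have PQ: "?P j \<subseteq> ?Q \<times> ?Q" if "j \<le> r" for j
      using that True contained_sum_le[of lam] contained_sum_le[of _ mu]
      by (fastforce simp: ribbon_pairs_def skew_size_def partitions_upto_def N_def)
    have "mcoeff (skew_schur lam mu * quantum_power_sum r) \<alpha>
        = (\<Sum>(\<beta>, \<gamma>)\<in>antidiag \<alpha>.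
            - inverse (q - 1) * ((1 - q) ^ card (Poly_Mapping.keys \<gamma>) * schur_coeff \<beta> lam mu))"
      unfolding lhs
    proof (intro sum.cong refl, clarify)
      fix \<beta> \<gamma> assume p: "(\<beta>, \<gamma>) \<in> antidiag \<alpha>"
      have "degree_of \<gamma> = r" if "schur_coeff \<beta> lam mu \<noteq> (0 :: qfield)"
        using schur_coeff_nonzero[OF that] deg[OF p] True by simp
      then show "schur_coeff \<beta> lam mu *
          (if degree_of \<gamma> = r then - inverse (q - 1) * (1 - q) ^ card (Poly_Mapping.keys \<gamma>) else 0)
        = - inverse (q - 1) * ((1 - q) ^ card (Poly_Mapping.keys \<gamma>) * schur_coeff \<beta> lam mu)"
        by (cases "schur_coeff \<beta> lam mu = (0 :: qfield)") simp_all
    qed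
    also have "\<dots> = - inverse (q - 1) * (\<Sum>(\<beta>, \<gamma>)\<in>antidiag \<alpha>.
        (1 - q) ^ card (Poly_Mapping.keys \<gamma>) * schur_coeff \<beta> lam mu)"
      by (simp add: sum_distrib_left split_def)
    also have "\<dots> = - inverse (q - 1) * (\<Sum>(rho, nu)\<in>?Q \<times> ?Q. ?G rho nu)"
    proof -
      have "lam \<in> ?Q" "mu \<in> ?Q" "sum_list mu + degree_of \<alpha> \<le> N"
        using assms(1,2) by (simp_all add: partitions_upto_def N_def)
      then show ?thesis by (simp only: schur_coeff_ribbon_conjugation)
    qed
    also have "(\<Sum>(rho, nu)\<in>?Q \<times> ?Q. ?G rho nu) = (\<Sum>(rho, nu)\<in>(\<Union>j\<in>{0..r}. ?P j). ?G rho nu)"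
    proof (rule sum.mono_neutral_right)
      show "finite (?Q \<times> ?Q)" by simp
      show "(\<Union>j\<in>{0..r}. ?P j) \<subseteq> ?Q \<times> ?Q" by (intro UN_least PQ) simp
      show "\<forall>p\<in>?Q \<times> ?Q - (\<Union>j\<in>{0..r}. ?P j). (case p of (rho, nu) \<Rightarrow> ?G rho nu) = 0"
      proof (clarify, rule ccontr)
        fix rho nu
        assume Q: "rho \<in> ?Q" "nu \<in> ?Q" and out: "(rho, nu) \<notin> (\<Union>j\<in>{0..r}. ?P j)" and nz: "?G rho nu \<noteq> 0"
        have br: "is_broken_ribbon rho lam" "is_broken_ribbon mu nu"
          and sc: "schur_coeff \<alpha> rho nu \<noteq> (0 :: qfield)"
          using nz by (auto simp: ribbon_weight_def split: if_splits)
        have c: "contained lam rho" "contained nu mu" using br by (auto simp: is_broken_ribbon_def)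
        have s: "sum_list rho = sum_list nu + degree_of \<alpha>" by (rule schur_coeff_nonzero[OF sc])
        let ?j = "sum_list mu - sum_list nu"
        have "?j \<le> r" "sum_list rho - sum_list lam = r - ?j"
          using s True contained_sum_le[OF c(1)] contained_sum_le[OF c(2)] by linarith+
        then have "(rho, nu) \<in> ?P ?j" "?j \<in> {0..r}"
          using Q br c by (auto simp: ribbon_pairs_def skew_size_def partitions_upto_def)
        then show False using out by blast
      qed
    qed
    also have "\<dots> = (\<Sum>j=0..r. \<Sum>(rho, nu)\<in>?P j. ?G rho nu)"
      by (rule sum.UNION_disjoint) (auto simp: ribbon_pairs_def simp del: finite_ribbon_pairs
          intro: finite_ribbon_pairs[unfolded ribbon_pairs_def])
    also have "- inverse (q - 1) * \<dots> = mcoeff ?rhs \<alpha>"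
      unfolding rhs sum_distrib_left
    proof (intro sum.cong refl, clarify)
      fix j rho nu assume j: "j \<in> {0..r}" and p: "(rho, nu) \<in> ?P j"
      have "r + 1 - j = Suc (sum_list rho - sum_list lam)"
        using p j by (simp add: ribbon_pairs_def skew_size_def)
      moreover have "is_partition rho" "is_partition nu" "is_broken_ribbon rho lam" "is_broken_ribbon mu nu"
        using p by (simp_all add: ribbon_pairs_def)
      ultimately have "(-1) ^ (r + 1 - j) * ?c rho nu
          = - inverse (q - 1) * (ribbon_weight 1 (- q) lam rho * ribbon_weight q (- 1) nu mu)"
        using ribbon_sign assms(1,2) by simp
      then show "- inverse (q - 1) * ?G rho nu
          = (-1) ^ (r + 1 - j) * (?c rho nu * schur_coeff \<alpha> rho nu)"
        by (simp only: mult.assoc[symmetric]) (simp only: mult_ac)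
    qed
    finally show ?thesis .
  qed
qed

end
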